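(* Let $k\ge 2$ and let $F_1,\dots,F_k$ be continuous cumulative distribution functions supported on $[0,1]$. Let $\{(Y_j,Z_j)\}_{j=1}^n$ be $n$ i.i.d. samples from the first-price auction with bid distributions $F_1,\dots,F_k$, and let $\delta\in(0,1)$. Then there exists a polynomial-time estimation algorithm that computes from these samples cumulative distribution functions $\hat F_i$, $i\in[k]$, such that for every $p,\gamma\ge 0$ with $\Pr(Y\le p)\ge\gamma$ (where $(Y,Z)$ is a sample from the same auction) and every $\varepsilon\in(0,\gamma/2]$, $$\Pr\left(\max_{x\in[p,1]}\big|\hat F_i(x)-F_i(x)\big|\le\varepsilon\right)\ \ge\ 1-\delta\qquad\text{for all } i\in[k],$$ assuming that $$n=\tilde\Theta\left(\frac{\log(k/\delta)}{\gamma^4\varepsilon^2}\right).$$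
   Context: Notation: $[k]=\{1,\dots,k\}$. A cumulative distribution function (CDF) $F$ is supported on $[0,1]$ if $F(x)=0$ for all $x<0$ and $F(1)=1$. First-price auction data: a sample $(Y,Z)$ from the first-price auction with bid distributions $F_1,\dots,F_k$ is generated by drawing $X_i\sim F_i$ independently for $i\in[k]$ and observing $(Y,Z)=(\max_{i\in[k]}X_i,\ \arg\max_{i\in[k]}X_i)$. The number $k$ of bidders is known. Order notation: constants hidden in $O,\Theta$ are absolute (independent of the distributions and of all parameters). The phrase "assuming $n=\tilde\Theta(f)$" means that there are absolute constants $C$ and $c\ge 1$ such that $n=C f\log^{c} f$ samples suffice for the conclusion. "Polynomial time" means polynomial in the number $n$ of samples. *)

theory Defs
  imports "HOL-Probability.Probability" "HOL-Computational_Algebra.Polynomial"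
begin

section \<open>The first-price auction\<close>

definition is_cdf :: "(real \<Rightarrow> real) \<Rightarrow> bool" where
  "is_cdf F \<longleftrightarrow> (\<exists>M. real_distribution M \<and> F = cdf M)"

definition supported_01 :: "(real \<Rightarrow> real) \<Rightarrow> bool" where
  "supported_01 F \<longleftrightarrow> (\<forall>x<0. F x = 0) \<and> F 1 = 1"

text \<open>Ties are broken towards the smallest index; for continuous bid distributions they have
  probability 0, so this choice does not affect the law below.\<close>

definition auction_outcome :: "nat \<Rightarrow> (nat \<Rightarrow> real) \<Rightarrow> real \<times> nat" where
  "auction_outcome k X =
     (Max (X ` {1..k}), LEAST i. i \<in> {1..k} \<and> X i = Max (X ` {1..k}))"

text \<open>The joint law of \<open>(Y, Z)\<close>. If \<open>F i\<close> is a CDF, then \<^term>\<open>interval_measure (F i)\<close> is the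
  distribution with that CDF.\<close>

definition first_price_auction ::
    "nat \<Rightarrow> (nat \<Rightarrow> real \<Rightarrow> real) \<Rightarrow> (real \<times> nat) measure" where
  "first_price_auction k F =
     distr (\<Pi>\<^sub>M i\<in>{1..k}. interval_measure (F i))
           (borel \<Otimes>\<^sub>M count_space UNIV) (auction_outcome k)"

definition auction_samples ::
    "nat \<Rightarrow> (nat \<Rightarrow> real \<Rightarrow> real) \<Rightarrow> nat \<Rightarrow> (nat \<Rightarrow> real \<times> nat) measure" where
  "auction_samples k F n = (\<Pi>\<^sub>M j\<in>{..<n}. first_price_auction k F)"


section \<open>Algorithms: programs for a real random-access machine\<close>

text \<open>
  The machine has finitely many (per program) unbounded arrays of natural numbers and of real
  numbers. Reals are exact and support the field operations and comparison at unit cost; there is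
  no rounding, and the only constants are natural numbers. Naturals support only addition,
  truncated subtraction and comparison, so that unit cost is realistic for them, and they are used
  for addressing and counting. A program contains only finitely many expressions, so charging one
  unit per assignment or test, irrespective of the size of the expression, changes running times
  by at most a constant factor.
\<close>

record state =
  nats :: "nat \<Rightarrow> nat \<Rightarrow> nat"
  reals :: "nat \<Rightarrow> nat \<Rightarrow> real"

datatype nexp =
    NConst nat
  | NGet nat nexp
  | NAdd nexp nexp
  | NSub nexp nexp

datatype rexp =
    RNat nexp
  | RGet nat nexp
  | RAdd rexp rexp
  | RSub rexp rexp
  | RMul rexp rexp
  | RDiv rexp rexp

datatype bexp =
    NLess nexp nexp
  | RLess rexp rexp
  | BNot bexp
  | BAnd bexp bexp

datatype com =
    Skip
  | NAssign nat nexp nexp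
  | RAssign nat nexp rexp
  | Seq com com
  | Cond bexp com com
  | Loop bexp com

primrec nval :: "nexp \<Rightarrow> state \<Rightarrow> nat" where
  "nval (NConst c) s = c"
| "nval (NGet a e) s = nats s a (nval e s)"
| "nval (NAdd e f) s = nval e s + nval f s"
| "nval (NSub e f) s = nval e s - nval f s"

primrec rval :: "rexp \<Rightarrow> state \<Rightarrow> real" where
  "rval (RNat e) s = real (nval e s)"
| "rval (RGet a e) s = reals s a (nval e s)"
| "rval (RAdd e f) s = rval e s + rval f s"
| "rval (RSub e f) s = rval e s - rval f s"
| "rval (RMul e f) s = rval e s * rval f s"
| "rval (RDiv e f) s = rval e s / rval f s"

primrec bval :: "bexp \<Rightarrow> state \<Rightarrow> bool" where
  "bval (NLess e f) s \<longleftrightarrow> nval e s < nval f s"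
| "bval (RLess e f) s \<longleftrightarrow> rval e s < rval f s"
| "bval (BNot b) s \<longleftrightarrow> \<not> bval b s"
| "bval (BAnd b c) s \<longleftrightarrow> bval b s \<and> bval c s"

definition upd :: "(nat \<Rightarrow> nat \<Rightarrow> 'a) \<Rightarrow> nat \<Rightarrow> nat \<Rightarrow> 'a \<Rightarrow> nat \<Rightarrow> nat \<Rightarrow> 'a" where
  "upd A a j v = A(a := (A a)(j := v))"

text \<open>\<open>exec c s t s'\<close>: started in \<open>s\<close>, the program \<open>c\<close> halts in \<open>s'\<close> after \<open>t\<close> steps.\<close>

inductive exec :: "com \<Rightarrow> state \<Rightarrow> nat \<Rightarrow> state \<Rightarrow> bool" where
  Skip: "exec Skip s 1 s"
| NAssign: "exec (NAssign a e f) s 1 (s\<lparr>nats := upd (nats s) a (nval e s) (nval f s)\<rparr>)"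
| RAssign: "exec (RAssign a e f) s 1 (s\<lparr>reals := upd (reals s) a (nval e s) (rval f s)\<rparr>)"
| Seq: "exec c s t s' \<Longrightarrow> exec d s' u s'' \<Longrightarrow> exec (Seq c d) s (t + u) s''"
| CondT: "bval b s \<Longrightarrow> exec c s t s' \<Longrightarrow> exec (Cond b c d) s (t + 1) s'"
| CondF: "\<not> bval b s \<Longrightarrow> exec d s t s' \<Longrightarrow> exec (Cond b c d) s (t + 1) s'"
| LoopF: "\<not> bval b s \<Longrightarrow> exec (Loop b c) s 1 s"
| LoopT: "bval b s \<Longrightarrow> exec c s t s' \<Longrightarrow> exec (Loop b c) s' u s'' \<Longrightarrow>
          exec (Loop b c) s (t + u + 1) s''"

inductive_cases exec_cases:
  "exec Skip s t s'"
  "exec (NAssign a e f) s t s'"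
  "exec (RAssign a e f) s t s'"
  "exec (Seq c d) s t s'"
  "exec (Cond b c d) s t s'"
  "exec (Loop b c) s t s'"

lemma exec_deterministic:
  "exec c s t s' \<Longrightarrow> exec c s u s'' \<Longrightarrow> u = t \<and> s'' = s'"
proof (induction arbitrary: u s'' rule: exec.induct)
  case (Seq c s t s' d v r)
  from Seq.prems obtain t1 s1 v1 where
    1: "exec c s t1 s1" "exec d s1 v1 s''" "u = t1 + v1"
    by (rule exec_cases)
  show ?case using Seq.IH(1)[OF 1(1)] Seq.IH(2) 1(2,3) by auto
next
  case (CondT b s c t s' d)
  from CondT.prems obtain t1 where "exec c s t1 s''" "u = t1 + 1"
    by (rule exec_cases) (use CondT.hyps(1) in auto)
  then show ?case using CondT.IH by auto
next
  case (CondF b s d t s' c)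
  from CondF.prems obtain t1 where "exec d s t1 s''" "u = t1 + 1"
    by (rule exec_cases) (use CondF.hyps(1) in auto)
  then show ?case using CondF.IH by auto
next
  case (LoopT b s c t s' v r)
  from LoopT.prems obtain t1 s1 v1 where
    1: "exec c s t1 s1" "exec (Loop b c) s1 v1 s''" "u = t1 + v1 + 1"
    by (rule exec_cases) (use LoopT.hyps(1) in auto)
  show ?case using LoopT.IH(1)[OF 1(1)] LoopT.IH(2) 1(2,3) by auto
next
  case (LoopF b s c)
  from LoopF.prems show ?case by (rule exec_cases) (use LoopF.hyps in auto)
qed (erule exec_cases; simp)+

definition final_state :: "com \<Rightarrow> state \<Rightarrow> state" where
  "final_state c s = (THE s'. \<exists>t. exec c s t s')"


section \<open>Estimators\<close>

text \<open>
  Input: the number of samples, the number of bidders, \<open>\<delta>\<close>, and the samples \<open>S j = (Y\<^sub>j, Z\<^sub>j)\<close>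
  for \<open>j < n\<close>. All other cells are 0.
\<close>

definition input_state :: "nat \<Rightarrow> real \<Rightarrow> nat \<Rightarrow> (nat \<Rightarrow> real \<times> nat) \<Rightarrow> state" where
  "input_state k \<delta> n S =
     \<lparr>nats = (\<lambda>a j. if a = 0 \<and> j = 0 then n
                    else if a = 0 \<and> j = 1 then k
                    else if a = 1 \<and> j < n then snd (S j)
                    else 0),
      reals = (\<lambda>a j. if a = 0 \<and> j = 0 then \<delta>
                     else if a = 1 \<and> j < n then fst (S j)
                     else 0)\<rparr>"

text \<open>
  Output: a list, of length \<open>nats s 2 0\<close>, of triples consisting of a bidder (natural array 3), a
  location (real array 2) and a mass (real array 3). The estimated distribution of bidder \<open>i\<close> has
  the atoms listed for \<open>i\<close>, and its remaining mass is at 0. The position of the remaining mass is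
  implicit because \<open>k\<close> need not be polynomial in the number of samples, so that a list that
  mentions every bidder could be too long.
\<close>

definition output_cdf :: "state \<Rightarrow> nat \<Rightarrow> real \<Rightarrow> real" where
  "output_cdf s i x =
     (if x < 0 then 0
      else 1 - (\<Sum>m | m < nats s 2 0 \<and> nats s 3 m = i \<and> x < reals s 2 m. reals s 3 m))"

definition estimate ::
    "com \<Rightarrow> nat \<Rightarrow> real \<Rightarrow> nat \<Rightarrow> (nat \<Rightarrow> real \<times> nat) \<Rightarrow> nat \<Rightarrow> real \<Rightarrow> real" where
  "estimate c k \<delta> n S = output_cdf (final_state c (input_state k \<delta> n S))"

definition admissible_input :: "nat \<Rightarrow> real \<Rightarrow> nat \<Rightarrow> (nat \<Rightarrow> real \<times> nat) \<Rightarrow> bool" where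
  "admissible_input k \<delta> n S \<longleftrightarrow>
     2 \<le> k \<and> 0 < \<delta> \<and> \<delta> < 1 \<and> (\<forall>j<n. fst (S j) \<in> {0..1} \<and> snd (S j) \<in> {1..k})"

definition polynomial_time :: "com \<Rightarrow> bool" where
  "polynomial_time c \<longleftrightarrow>
     (\<exists>q :: nat poly. \<forall>k \<delta> n S. admissible_input k \<delta> n S \<longrightarrow>
        (\<exists>t s'. exec c (input_state k \<delta> n S) t s' \<and> t \<le> poly q n))"

definition outputs_cdfs :: "com \<Rightarrow> bool" where
  "outputs_cdfs c \<longleftrightarrow>
     (\<forall>k \<delta> n S. admissible_input k \<delta> n S \<longrightarrow> (\<forall>i\<in>{1..k}. is_cdf (estimate c k \<delta> n S i)))"

end

theory Submission imports Defs begin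

text \<open>
  Let \<open>G y = P(Y \<le> y)\<close> and \<open>H\<^sub>i y = P(Y \<le> y, Z = i)\<close>. Bidder \<open>i\<close> wins with a bid in \<open>(s, t]\<close> if
  their bid is in \<open>(s, t]\<close> and the others are at most \<open>s\<close>, and only if the others are at most \<open>t\<close>;
  since \<open>G\<close> is the product of the \<open>F\<^sub>j\<close>, this gives
  \<open>(H\<^sub>i t - H\<^sub>i s) / G t \<le> ln (F\<^sub>i t) - ln (F\<^sub>i s) \<le> (H\<^sub>i t - H\<^sub>i s) / G s\<close>. The Kaplan--Meier product
  over the winning bids of \<open>i\<close> above \<open>x\<close>, with a factor \<open>1 - 1 / r\<close> for a bid of rank \<open>r\<close>, satisfies
  exactly the same two inequalities with respect to the empirical versions of \<open>G\<close> and \<open>H\<^sub>i\<close>, and it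
  can be computed by field operations alone. Comparing the two Riemann sums on a fine grid in
  \<open>[x, 1]\<close> by summation by parts, an error \<open>\<eta>\<close> in \<open>G\<close> and \<open>H\<^sub>i\<close>, where \<open>G x \<ge> \<gamma>\<close>, costs at most
  \<open>12 \<eta> / \<gamma>\<^sup>2\<close> in \<open>ln F\<^sub>i\<close>, hence in \<open>F\<^sub>i\<close>. Hoeffding's inequality on a grid of quantiles provides
  \<open>\<eta> = \<gamma>\<^sup>2 \<epsilon> / 12\<close>.
\<close>

section \<open>The Kaplan--Meier program\<close>

definition triple :: "(state \<Rightarrow> bool) \<Rightarrow> com \<Rightarrow> nat \<Rightarrow> (state \<Rightarrow> bool) \<Rightarrow> bool" where
  "triple P c T Q \<longleftrightarrow> (\<forall>s. P s \<longrightarrow> (\<exists>t s'. exec c s t s' \<and> t \<le> T \<and> Q s'))"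

lemma tripleI: "(\<And>s. P s \<Longrightarrow> \<exists>t s'. exec c s t s' \<and> t \<le> T \<and> Q s') \<Longrightarrow> triple P c T Q"
  by (simp add: triple_def)

lemma triple_conseq:
  assumes "triple P c T Q" "\<And>s. P' s \<Longrightarrow> P s" "\<And>s. Q s \<Longrightarrow> Q' s" "T \<le> T'"
  shows "triple P' c T' Q'"
  using assms unfolding triple_def by (meson le_trans)

lemma triple_NAssign:
  assumes "\<And>s. P s \<Longrightarrow> Q (s\<lparr>nats := upd (nats s) a (nval e s) (nval f s)\<rparr>)"
  shows "triple P (NAssign a e f) 1 Q"
  using assms exec.NAssign by (meson order_refl tripleI)

lemma triple_RAssign:
  assumes "\<And>s. P s \<Longrightarrow> Q (s\<lparr>reals := upd (reals s) a (nval e s) (rval f s)\<rparr>)"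
  shows "triple P (RAssign a e f) 1 Q"
  using assms exec.RAssign by (meson order_refl tripleI)

lemma triple_Seq:
  assumes "triple P c T R" "triple R d U Q"
  shows "triple P (Seq c d) (T + U) Q"
  using assms unfolding triple_def by (meson exec.Seq add_mono)

lemma triple_Skip: "(\<And>s. P s \<Longrightarrow> Q s) \<Longrightarrow> triple P Skip 1 Q"
  using exec.Skip by (meson order_refl tripleI)

lemma triple_Cond:
  assumes "triple (\<lambda>s. P s \<and> bval b s) c T Q" "triple (\<lambda>s. P s \<and> \<not> bval b s) d T Q"
  shows "triple P (Cond b c d) (T + 1) Q"
  using assms unfolding triple_def by (meson exec.CondT exec.CondF add_le_mono1)

text \<open>The invariant is indexed by the number of completed rounds, so \<open>m\<close> decides
  the guard, and the induction is on the number \<open>d\<close> of rounds left. Each round pays 1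
  for its test; the last 1 pays for the failing test.\<close>

lemma triple_Loop:
  assumes body: "\<And>m. m < n \<Longrightarrow> triple (I m) c T (I (Suc m))"
    and guard: "\<And>m s. I m s \<Longrightarrow> m \<le> n \<Longrightarrow> bval b s \<longleftrightarrow> m < n"
  shows "triple (I 0) (Loop b c) (n * (T + 1) + 1) (I n)"
proof -
  have "triple (I (n - d)) (Loop b c) (d * (T + 1) + 1) (I n)" if "d \<le> n" for d
    using that
  proof (induction d)
    case 0
    then show ?case
      using exec.LoopF guard by (intro tripleI) (metis diff_zero less_irrefl order_refl mult_0 add_0)
  next
    case (Suc d)
    have eq: "Suc (n - Suc d) = n - d" using Suc.prems by simp
    show ?case
    proof (rule tripleI)
      fix s assume s: "I (n - Suc d) s"
      then have b: "bval b s" using guard Suc.prems by simp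
      from s body[of "n - Suc d"] Suc.prems eq
      obtain t s' where 1: "exec c s t s'" "t \<le> T" "I (n - d) s'"
        unfolding triple_def by auto
      from Suc 1(3) obtain u s'' where 2: "exec (Loop b c) s' u s''" "u \<le> d * (T + 1) + 1" "I n s''"
        unfolding triple_def by auto
      have "exec (Loop b c) s (t + u + 1) s''" by (rule exec.LoopT[OF b 1(1) 2(1)])
      with 1(2) 2(2,3) show "\<exists>t s'. exec (Loop b c) s t s' \<and> t \<le> Suc d * (T + 1) + 1 \<and> I n s'"
        by (intro exI[of _ "t + u + 1"] exI[of _ s'']) auto
    qed
  qed
  from this[of n] show ?thesis by simp
qed

text \<open>Natural array 4 holds the loop counters, natural array 5 the ranks; \<open>nats s 0 0\<close> is the
  number of samples.\<close>

definition for_loop :: "nat \<Rightarrow> com \<Rightarrow> com" where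
  "for_loop a c =
     Seq (NAssign 4 (NConst a) (NConst 0))
       (Loop (NLess (NGet 4 (NConst a)) (NGet 0 (NConst 0)))
         (Seq c (NAssign 4 (NConst a) (NAdd (NGet 4 (NConst a)) (NConst 1)))))"

text \<open>The postcondition of the body refers to the state after the increment, so that the
  invariant can speak about the counter itself. Each round costs 2 more than the body, for the test
  and the increment; the final 2 is for the initialisation and the failing test.\<close>

lemma triple_for_loop:
  assumes body: "\<And>m. m < n \<Longrightarrow>
      triple (I m) c T (\<lambda>s. nats s 4 a = m \<and> I (Suc m) (s\<lparr>nats := upd (nats s) 4 a (Suc m)\<rparr>))"
    and inv: "\<And>m s. I m s \<Longrightarrow> nats s 0 0 = n \<and> nats s 4 a = m"
    and init: "\<And>s. P s \<Longrightarrow> I 0 (s\<lparr>nats := upd (nats s) 4 a 0\<rparr>)"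
  shows "triple P (for_loop a c) (n * (T + 2) + 2) (I n)"
proof -
  let ?b = "NLess (NGet 4 (NConst a)) (NGet 0 (NConst 0))"
  let ?d = "Seq c (NAssign 4 (NConst a) (NAdd (NGet 4 (NConst a)) (NConst 1)))"
  have "triple (I m) ?d (T + 1) (I (Suc m))" if "m < n" for m
    by (rule triple_Seq[OF body[OF that]], rule triple_NAssign) auto
  then have "triple (I 0) (Loop ?b ?d) (n * (T + 1 + 1) + 1) (I n)"
    by (rule triple_Loop) (use inv in auto)
  moreover have "triple P (NAssign 4 (NConst a) (NConst 0)) 1 (I 0)"
    by (rule triple_NAssign) (use init in auto)
  ultimately have "triple P (for_loop a c) (1 + (n * (T + 1 + 1) + 1)) (I n)"
    unfolding for_loop_def by (rule triple_Seq[rotated])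
  then show ?thesis by (rule triple_conseq) auto
qed

section \<open>Ranks, masses and the product estimator\<close>

definition bid_rank :: "nat \<Rightarrow> (nat \<Rightarrow> real \<times> nat) \<Rightarrow> nat \<Rightarrow> nat" where
  "bid_rank n S j = card {l. l < n \<and> fst (S l) \<le> fst (S j)}"

text \<open>Ties between bids are broken by the index, so that the masses below telescope to the product
  \<open>kaplan_meier\<close> even if bids coincide.\<close>

definition later :: "(nat \<Rightarrow> real \<times> nat) \<Rightarrow> nat \<Rightarrow> nat \<Rightarrow> bool" where
  "later S m j \<longleftrightarrow> snd (S j) = snd (S m) \<and>
     (fst (S m) < fst (S j) \<or> fst (S j) = fst (S m) \<and> m < j)"

text \<open>The jump of the product at the bid \<open>m\<close>: the factors of the later bids leave
  a product \<open>P\<close>, and the factor \<open>1 - 1 / r\<close> removes \<open>P / r\<close>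
  from it.\<close>

definition km_mass :: "nat \<Rightarrow> (nat \<Rightarrow> real \<times> nat) \<Rightarrow> nat \<Rightarrow> real" where
  "km_mass n S m = 1 / real (bid_rank n S m) *
     (\<Prod>j | j < n \<and> later S m j. 1 - 1 / real (bid_rank n S j))"

definition kaplan_meier :: "nat \<Rightarrow> (nat \<Rightarrow> real \<times> nat) \<Rightarrow> nat \<Rightarrow> real \<Rightarrow> real" where
  "kaplan_meier n S i x =
     (\<Prod>j | j < n \<and> snd (S j) = i \<and> x < fst (S j). 1 - 1 / real (bid_rank n S j))"

abbreviation "outer_ix \<equiv> NGet 4 (NConst 0)"
abbreviation "inner_ix \<equiv> NGet 4 (NConst 1)"

definition rank_prog :: com where
  "rank_prog = for_loop 0
     (Seq (NAssign 5 outer_ix (NConst 0))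
       (for_loop 1
         (Cond (RLess (RGet 1 outer_ix) (RGet 1 inner_ix)) Skip
           (NAssign 5 outer_ix (NAdd (NGet 5 outer_ix) (NConst 1))))))"

text \<open>Encodes \<open>later\<close> by strict comparisons, negation and conjunction: equality
  of bidders is two negated comparisons. Once the inner bid is known not to be below the outer one,
  the last conjunct asks, by De Morgan, for a larger bid or a larger index.\<close>

definition later_test :: bexp where
  "later_test =
     BAnd (BAnd (BNot (NLess (NGet 1 inner_ix) (NGet 1 outer_ix))) (BNot (NLess (NGet 1 outer_ix) (NGet 1 inner_ix))))
       (BAnd (BNot (RLess (RGet 1 inner_ix) (RGet 1 outer_ix)))
         (BNot (BAnd (BNot (RLess (RGet 1 outer_ix) (RGet 1 inner_ix))) (BNot (NLess outer_ix inner_ix)))))"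

definition mass_prog :: com where
  "mass_prog = for_loop 0
     (Seq (NAssign 3 outer_ix (NGet 1 outer_ix))
     (Seq (RAssign 2 outer_ix (RGet 1 outer_ix))
     (Seq (RAssign 3 outer_ix (RDiv (RNat (NConst 1)) (RNat (NGet 5 outer_ix))))
       (for_loop 1
         (Cond later_test
           (RAssign 3 outer_ix (RMul (RGet 3 outer_ix)
              (RSub (RNat (NConst 1)) (RDiv (RNat (NConst 1)) (RNat (NGet 5 inner_ix))))))
           Skip)))))"

definition km_prog :: com where
  "km_prog = Seq rank_prog (Seq mass_prog (NAssign 2 (NConst 0) (NGet 0 (NConst 0))))"

definition has_samples :: "nat \<Rightarrow> (nat \<Rightarrow> real \<times> nat) \<Rightarrow> state \<Rightarrow> bool" where
  "has_samples n S s \<longleftrightarrow> nats s 0 0 = n \<and> (\<forall>j<n. nats s 1 j = snd (S j) \<and> reals s 1 j = fst (S j))"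

text \<open>The parameter \<open>m\<close> counts the cells already filled, so that this predicate
  is a loop invariant and, at \<open>m = n\<close>, a pre- or postcondition.\<close>

definition has_ranks :: "nat \<Rightarrow> nat \<Rightarrow> (nat \<Rightarrow> real \<times> nat) \<Rightarrow> state \<Rightarrow> bool" where
  "has_ranks m n S s \<longleftrightarrow> has_samples n S s \<and> (\<forall>j<m. nats s 5 j = bid_rank n S j)"

definition has_masses :: "nat \<Rightarrow> nat \<Rightarrow> (nat \<Rightarrow> real \<times> nat) \<Rightarrow> state \<Rightarrow> bool" where
  "has_masses m n S s \<longleftrightarrow> has_ranks n n S s \<and>
     (\<forall>j<m. nats s 3 j = snd (S j) \<and> reals s 2 j = fst (S j) \<and> reals s 3 j = km_mass n S j)"

lemmas has_defs = has_masses_def has_ranks_def has_samples_def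

lemma Collect_less_Suc: "{l. l < Suc j \<and> P l} = (if P j then insert j {l. l < j \<and> P l} else {l. l < j \<and> P l})"
  by (auto simp: less_Suc_eq)

lemma triple_rank_prog:
  "triple (has_samples n S) rank_prog (n * (1 + (n * (2 + 2) + 2) + 2) + 2) (has_ranks n n S)"
proof -
  let ?I = "\<lambda>m s. has_ranks m n S s \<and> nats s 4 0 = m"
  let ?J = "\<lambda>m j s. has_ranks m n S s \<and> nats s 4 0 = m \<and> nats s 4 1 = j \<and>
                nats s 5 m = card {l. l < j \<and> fst (S l) \<le> fst (S m)}"
  let ?inc = "Cond (RLess (RGet 1 outer_ix) (RGet 1 inner_ix)) Skip
           (NAssign 5 outer_ix (NAdd (NGet 5 outer_ix) (NConst 1)))"
  have inner: "triple (?J m j) ?inc (1 + 1)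
       (\<lambda>s. nats s 4 1 = j \<and> ?J m (Suc j) (s\<lparr>nats := upd (nats s) 4 1 (Suc j)\<rparr>))"
    if "m < n" "j < n" for m j
    by (rule triple_Cond, rule triple_Skip, use that in \<open>force simp: has_defs upd_def Collect_less_Suc\<close>,
      rule triple_NAssign, use that in \<open>auto simp: has_defs upd_def Collect_less_Suc not_less\<close>)
  have "triple (?I m) (Seq (NAssign 5 outer_ix (NConst 0)) (for_loop 1 ?inc))
      (1 + (n * (1 + 1 + 2) + 2)) (?J m n)" if "m < n" for m
    by (rule triple_Seq, rule triple_NAssign[where Q="\<lambda>s. ?I m s \<and> nats s 5 m = 0"],
      use that in \<open>force simp: has_defs upd_def\<close>,
      rule triple_for_loop, rule inner, use that in \<open>force simp: has_defs upd_def\<close>)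
      (use that in \<open>auto simp: has_defs upd_def\<close>)
  \<comment> \<open>After the inner loop the count runs over all \<open>l < n\<close>, which is
    \<open>bid_rank n S m\<close>, so cell \<open>m\<close> joins the finished ones.\<close>
  then have "triple (?I m) (Seq (NAssign 5 outer_ix (NConst 0)) (for_loop 1 ?inc))
      (1 + (n * (1 + 1 + 2) + 2)) (\<lambda>s. nats s 4 0 = m \<and> ?I (Suc m) (s\<lparr>nats := upd (nats s) 4 0 (Suc m)\<rparr>))"
    if "m < n" for m
    by (rule triple_conseq) (use that in \<open>auto simp: has_defs upd_def less_Suc_eq bid_rank_def\<close>)
  then have "triple (has_samples n S) rank_prog (n * (1 + (n * (1 + 1 + 2) + 2) + 2) + 2) (?I n)"
    unfolding rank_prog_def
    by (rule triple_for_loop) (auto simp: has_defs upd_def)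
  then show ?thesis by (rule triple_conseq) auto
qed

lemma triple_mass_prog:
  "triple (has_ranks n n S) mass_prog (n * (3 + (n * (2 + 2) + 2) + 2) + 2) (has_masses n n S)"
proof -
  let ?I = "\<lambda>m s. has_masses m n S s \<and> nats s 4 0 = m"
  let ?A = "\<lambda>m s. ?I m s \<and> nats s 3 m = snd (S m)"
  let ?B = "\<lambda>m s. ?A m s \<and> reals s 2 m = fst (S m)"
  let ?C = "\<lambda>m s. ?B m s \<and> reals s 3 m = 1 / real (bid_rank n S m)"
  \<comment> \<open>\<open>?J\<close> builds on \<open>?B\<close> and not on \<open>?C\<close>,
    because the inner loop overwrites the initial mass by partial products. At \<open>j = 0\<close>
    the product is empty and \<open>?J\<close> follows from \<open>?C\<close>.\<close>
  let ?J = "\<lambda>m j s. ?B m s \<and> nats s 4 1 = j \<and> reals s 3 m =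
      1 / real (bid_rank n S m) * (\<Prod>l | l < j \<and> later S m l. 1 - 1 / real (bid_rank n S l))"
  let ?mul = "Cond later_test (RAssign 3 outer_ix (RMul (RGet 3 outer_ix)
              (RSub (RNat (NConst 1)) (RDiv (RNat (NConst 1)) (RNat (NGet 5 inner_ix)))))) Skip"
  let ?body = "Seq (NAssign 3 outer_ix (NGet 1 outer_ix)) (Seq (RAssign 2 outer_ix (RGet 1 outer_ix))
     (Seq (RAssign 3 outer_ix (RDiv (RNat (NConst 1)) (RNat (NGet 5 outer_ix)))) (for_loop 1 ?mul)))"
  have test: "bval later_test s \<longleftrightarrow> later S m j" if "?J m j s" "m < n" "j < n" for s m j
    using that by (auto simp: later_test_def later_def has_defs not_less)
  have inner: "triple (?J m j) ?mul (1 + 1)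
       (\<lambda>s. nats s 4 1 = j \<and> ?J m (Suc j) (s\<lparr>nats := upd (nats s) 4 1 (Suc j)\<rparr>))"
    if "m < n" "j < n" for m j
  proof (rule triple_Cond)
    show "triple (\<lambda>s. ?J m j s \<and> bval later_test s) (RAssign 3 outer_ix (RMul (RGet 3 outer_ix)
              (RSub (RNat (NConst 1)) (RDiv (RNat (NConst 1)) (RNat (NGet 5 inner_ix)))))) 1
       (\<lambda>s. nats s 4 1 = j \<and> ?J m (Suc j) (s\<lparr>nats := upd (nats s) 4 1 (Suc j)\<rparr>))"
    proof (rule triple_RAssign)
      fix s assume s: "?J m j s \<and> bval later_test s"
      then have "later S m j" using test that by blast
      let ?s' = "s\<lparr>reals := upd (reals s) 3 (nval outer_ix s) (rval (RMul (RGet 3 outer_ix)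
              (RSub (RNat (NConst 1)) (RDiv (RNat (NConst 1)) (RNat (NGet 5 inner_ix))))) s)\<rparr>"
      from s \<open>later S m j\<close> that
      show "nats ?s' 4 1 = j \<and> ?J m (Suc j) (?s'\<lparr>nats := upd (nats ?s') 4 1 (Suc j)\<rparr>)"
        by (simp add: has_defs upd_def Collect_less_Suc)
    qed
    show "triple (\<lambda>s. ?J m j s \<and> \<not> bval later_test s) Skip 1
       (\<lambda>s. nats s 4 1 = j \<and> ?J m (Suc j) (s\<lparr>nats := upd (nats s) 4 1 (Suc j)\<rparr>))"
    proof (rule triple_Skip)
      fix s assume s: "?J m j s \<and> \<not> bval later_test s"
      then have "\<not> later S m j" using test that by blast
      with s that show "nats s 4 1 = j \<and> ?J m (Suc j) (s\<lparr>nats := upd (nats s) 4 1 (Suc j)\<rparr>)"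
        by (simp add: has_defs upd_def Collect_less_Suc)
    qed
  qed
  have "triple (?I m) ?body (1 + (1 + (1 + (n * (1 + 1 + 2) + 2)))) (?J m n)" if "m < n" for m
    apply (rule triple_Seq, rule triple_NAssign[where Q="?A m"])
    using that apply (force simp: has_defs upd_def)
    apply (rule triple_Seq, rule triple_RAssign[where Q="?B m"])
    using that apply (force simp: has_defs upd_def)
    apply (rule triple_Seq, rule triple_RAssign[where Q="?C m"])
    using that apply (force simp: has_defs upd_def)
    apply (rule triple_for_loop, rule inner)
    using that by (auto simp: has_defs upd_def)
  then have "triple (?I m) ?body (1 + (1 + (1 + (n * (1 + 1 + 2) + 2))))
      (\<lambda>s. nats s 4 0 = m \<and> ?I (Suc m) (s\<lparr>nats := upd (nats s) 4 0 (Suc m)\<rparr>))"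
    if "m < n" for m
    by (rule triple_conseq) (use that in \<open>auto simp: has_defs upd_def less_Suc_eq km_mass_def\<close>)
  then have "triple (has_ranks n n S) mass_prog
      (n * (1 + (1 + (1 + (n * (1 + 1 + 2) + 2))) + 2) + 2) (?I n)"
    unfolding mass_prog_def
    by (rule triple_for_loop) (auto simp: has_defs upd_def)
  then show ?thesis by (rule triple_conseq) (auto simp: algebra_simps)
qed

text \<open>The bounds of the two double loops and of the last assignment add up to
  \<open>8 * n * n + 12 * n + 5\<close>. The number \<open>k\<close> does not enter, as no loop runs
  over the bidders.\<close>

lemma km_prog_exec:
  obtains t s where "exec km_prog (input_state k \<delta> n S) t s" "t \<le> 5 + 12 * n + 8 * n * n"
    "has_masses n n S s" "nats s 2 0 = n"
proof -
  have fin: "triple (has_masses n n S) (NAssign 2 (NConst 0) (NGet 0 (NConst 0))) 1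
      (\<lambda>s. has_masses n n S s \<and> nats s 2 0 = n)"
    by (rule triple_NAssign) (auto simp: has_defs upd_def)
  have "triple (has_samples n S) km_prog
     ((n * (1 + (n * (2 + 2) + 2) + 2) + 2) + ((n * (3 + (n * (2 + 2) + 2) + 2) + 2) + 1))
     (\<lambda>s. has_masses n n S s \<and> nats s 2 0 = n)"
    unfolding km_prog_def by (intro triple_Seq) (rule triple_rank_prog triple_mass_prog fin)+
  moreover have "has_samples n S (input_state k \<delta> n S)"
    by (simp add: has_samples_def input_state_def)
  ultimately obtain t s where ts: "exec km_prog (input_state k \<delta> n S) t s"
      "t \<le> (n * (1 + (n * (2 + 2) + 2) + 2) + 2) + ((n * (3 + (n * (2 + 2) + 2) + 2) + 2) + 1)"
      "has_masses n n S s" "nats s 2 0 = n"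
    unfolding triple_def by blast
  from ts(2) have "t \<le> 5 + 12 * n + 8 * n * n"
    by (simp add: algebra_simps)
  with ts show ?thesis using that by blast
qed

lemma polynomial_time_km_prog: "polynomial_time km_prog"
  unfolding polynomial_time_def
proof (intro exI[of _ "[:5, 12, 8:]"] allI impI)
  fix k \<delta> n S
  show "\<exists>t s'. exec km_prog (input_state k \<delta> n S) t s' \<and> t \<le> poly [:5, 12, 8:] n"
    by (rule km_prog_exec[of k \<delta> n S], intro exI conjI) (auto simp: algebra_simps)
qed

text \<open>Along a strict total order, \<open>a m\<close> times the product over the successors of
  \<open>m\<close> is the difference of two consecutive partial products, so the sum
  telescopes.\<close>

lemma sum_telescope_prod:
  fixes a :: "'a \<Rightarrow> 'b::comm_ring_1"
  assumes "finite A" "transp_on A R" "asymp_on A R" "totalp_on A R"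
  shows "(\<Sum>m\<in>A. a m * (\<Prod>j | j \<in> A \<and> R m j. 1 - a j)) = 1 - (\<Prod>j\<in>A. 1 - a j)"
  using assms
proof (induction A rule: finite_psubset_induct)
  case (psubset A)
  show ?case
  proof (cases "A = {}")
    case False
    \<comment> \<open>Split off the element without predecessor: its own product runs over all other
      elements, and no other product contains its factor.\<close>
    with Finite_Set.bex_min_element[OF psubset.hyps psubset.prems(2,1)]
    obtain m where m: "m \<in> A" "\<forall>x\<in>A. x \<noteq> m \<longrightarrow> \<not> R x m"
      by metis
    define B where "B = A - {m}"
    have B: "B \<subset> A" "finite B" "m \<notin> B" "A = insert m B"
      unfolding B_def using m(1) \<open>finite A\<close> by blast+
    have "(\<Sum>x\<in>B. a x * (\<Prod>j | j \<in> B \<and> R x j. 1 - a j)) = 1 - (\<Prod>j\<in>B. 1 - a j)"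
      using psubset.IH[OF B(1)] transp_on_subset[OF psubset.prems(1)]
        asymp_on_subset[OF psubset.prems(2)] totalp_on_subset[OF psubset.prems(3)] B(1)
      by blast
    moreover have "\<not> R x m" if "x \<in> B" for x
      using that m(2) by (auto simp: B_def)
    then have "{j. j \<in> A \<and> R x j} = {j. j \<in> B \<and> R x j}" if "x \<in> B" for x
      using that by (auto simp: B_def)
    moreover have "R m j \<longleftrightarrow> j \<noteq> m" if "j \<in> A" for j
      using m asymp_onD[OF psubset.prems(2) m(1) m(1)] totalp_onD[OF psubset.prems(3) m(1) that] that
      by metis
    then have "{j. j \<in> A \<and> R m j} = B"
      by (auto simp: B_def)
    ultimately show ?thesis
      using B(2,3) by (simp add: B(4) algebra_simps)
  qed simp
qed

lemma bid_rank_pos: "j < n \<Longrightarrow> 0 < bid_rank n S j"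
  by (auto simp: bid_rank_def card_gt_0_iff)

lemma sum_km_mass:
  "(\<Sum>m | m < n \<and> snd (S m) = i \<and> x < fst (S m). km_mass n S m) = 1 - kaplan_meier n S i x"
proof -
  let ?A = "{m. m < n \<and> snd (S m) = i \<and> x < fst (S m)}"
  have "(\<Sum>m\<in>?A. 1 / real (bid_rank n S m) * (\<Prod>j | j \<in> ?A \<and> later S m j. 1 - 1 / real (bid_rank n S j))) =
      1 - (\<Prod>j\<in>?A. 1 - 1 / real (bid_rank n S j))"
    by (rule sum_telescope_prod) (auto simp: transp_on_def asymp_on_def totalp_on_def later_def)
  moreover have "{j. j \<in> ?A \<and> later S m j} = {j. j < n \<and> later S m j}" if "m \<in> ?A" for m
    using that by (auto simp: later_def)
  ultimately show ?thesis
    by (simp add: km_mass_def kaplan_meier_def)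
qed

theorem estimate_km_prog:
  "0 \<le> x \<Longrightarrow> estimate km_prog k \<delta> n S i x = kaplan_meier n S i x"
  "x < 0 \<Longrightarrow> estimate km_prog k \<delta> n S i x = 0"
proof -
  obtain t s where s: "exec km_prog (input_state k \<delta> n S) t s" "has_masses n n S s" "nats s 2 0 = n"
    by (rule km_prog_exec)
  have final: "final_state km_prog (input_state k \<delta> n S) = s"
    unfolding final_state_def using s(1) exec_deterministic by blast
  have "(\<Sum>m | m < nats s 2 0 \<and> nats s 3 m = i \<and> x < reals s 2 m. reals s 3 m) =
      (\<Sum>m | m < n \<and> snd (S m) = i \<and> x < fst (S m). km_mass n S m)"
    using s(2,3) by (intro sum.cong) (auto simp: has_masses_def)
  then show "0 \<le> x \<Longrightarrow> estimate km_prog k \<delta> n S i x = kaplan_meier n S i x"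
    "x < 0 \<Longrightarrow> estimate km_prog k \<delta> n S i x = 0"
    by (simp_all add: estimate_def final output_cdf_def sum_km_mass)
qed

section \<open>The output is a distribution function\<close>

lemma km_factor: "j < n \<Longrightarrow> 1 - 1 / real (bid_rank n S j) \<in> {0..1}"
  using bid_rank_pos[of j n S] by simp

lemma kaplan_meier_bounds: "kaplan_meier n S i x \<in> {0..1}"
  using km_factor unfolding kaplan_meier_def
  by (auto intro!: prod_nonneg prod_le_1)

text \<open>Moves the dependence on \<open>x\<close> and on the winners from the index set into the
  factors, as monotonicity and measurability require.\<close>

lemma kaplan_meier_eq_prod:
  "kaplan_meier n S i x =
     (\<Prod>j<n. if snd (S j) = i \<and> x < fst (S j) then 1 - 1 / real (bid_rank n S j) else 1)"
  unfolding kaplan_meier_def by (rule prod.mono_neutral_cong_left) auto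

lemma mono_kaplan_meier: "x \<le> y \<Longrightarrow> kaplan_meier n S i x \<le> kaplan_meier n S i y"
  unfolding kaplan_meier_eq_prod using km_factor by (intro prod_mono) auto

text \<open>Each of the finitely many conditions \<open>x < fst (S j)\<close> keeps its truth value
  just to the right of \<open>x\<close>. This gives right-continuity of the output and, later,
  measurability of the success event.\<close>

lemma kaplan_meier_eventually_const:
  "eventually (\<lambda>y. kaplan_meier n S i y = kaplan_meier n S i x) (at_right x)"
proof -
  have "eventually (\<lambda>y. y < fst (S j) \<longleftrightarrow> x < fst (S j)) (at_right x)" for j
  proof (cases "x < fst (S j)")
    case True
    then show ?thesis
      by (intro eventually_at_rightI[of x "fst (S j)"]) auto
  next
    case False
    with eventually_at_right_less[of x] show ?thesis
      by (auto elim: eventually_mono)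
  qed
  then have "eventually (\<lambda>y. \<forall>j\<in>{..<n}. y < fst (S j) \<longleftrightarrow> x < fst (S j)) (at_right x)"
    by (simp add: eventually_ball_finite)
  then show ?thesis
    by eventually_elim (unfold kaplan_meier_def, intro prod.cong, auto)
qed

lemma outputs_cdfs_km_prog: "outputs_cdfs km_prog"
  unfolding outputs_cdfs_def
proof (intro allI impI ballI)
  fix k i n :: nat and \<delta> :: real and S
  assume adm: "admissible_input k \<delta> n S"
  define f where "f = estimate km_prog k \<delta> n S i"
  have f: "f x = (if x < 0 then 0 else kaplan_meier n S i x)" for x
    using estimate_km_prog by (simp add: f_def)
  have mono: "f x \<le> f y" if "x \<le> y" for x y
    using that kaplan_meier_bounds[of n S i y] by (auto simp: f mono_kaplan_meier)
  have right: "continuous (at_right x) f" for x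
  proof -
    have "eventually (\<lambda>y. f y = f x) (at_right x)"
    proof (cases "x < 0")
      case True
      then show ?thesis
        by (intro eventually_at_rightI[of x 0]) (auto simp: f)
    next
      case False
      with kaplan_meier_eventually_const[of n S i x] eventually_at_right_less[of x] show ?thesis
        by (auto elim: eventually_elim2 simp: f)
    qed
    then have "(f \<longlongrightarrow> f x) (at_right x)"
      by (rule tendsto_eventually)
    then show ?thesis by (simp add: continuous_within)
  qed
  have bot: "(f \<longlongrightarrow> 0) at_bot"
    by (rule tendsto_eventually, rule eventually_mono[OF eventually_gt_at_bot[of 0]]) (simp add: f)
  \<comment> \<open>Admissible bids are at most 1, so from 1 on the product is empty.\<close>
  have "f x = 1" if "1 \<le> x" for x
  proof -
    have "{j. j < n \<and> snd (S j) = i \<and> x < fst (S j)} = {}"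
      using adm that by (force simp: admissible_input_def)
    then show ?thesis using that by (simp add: f kaplan_meier_def del: Collect_empty_eq)
  qed
  then have top: "(f \<longlongrightarrow> 1) at_top"
    by (intro tendsto_eventually eventually_mono[OF eventually_ge_at_top[of 1]])
  show "is_cdf (estimate km_prog k \<delta> n S i)"
    unfolding is_cdf_def f_def[symmetric]
    using real_distribution_interval_measure[OF mono right bot top]
      cdf_interval_measure[OF mono right bot, symmetric] by blast
qed

section \<open>Comparison of cumulative hazards\<close>

text \<open>The intermediate value theorem yields points at which \<open>G\<close> takes equally
  spaced values. If \<open>G a = G b\<close>, all increments are 0, and jumping from
  \<open>a\<close> to \<open>b\<close> in the last step will do.\<close>

lemma quantile_grid:
  fixes G :: "real \<Rightarrow> real"
  assumes "a \<le> b" "continuous_on {a..b} G" "mono G" "0 < M"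
  obtains t where "t 0 = a" "t M = b" "\<And>i. i < M \<Longrightarrow> t i \<le> t (Suc i)"
    "\<And>i. i < M \<Longrightarrow> G (t (Suc i)) - G (t i) = (G b - G a) / real M"
proof (cases "G b = G a")
  case True
  show ?thesis
  proof
    fix i assume "i < M"
    show "(\<lambda>i. if i = M then b else a) i \<le> (if Suc i = M then b else a)"
      using assms(1) \<open>i < M\<close> by auto
    show "G (if Suc i = M then b else a) - G (if i = M then b else a) = (G b - G a) / real M"
      using True by auto
  qed (use assms in auto)
next
  case False
  then have less: "G a < G b"
    using monoD[OF assms(3,1)] by simp
  define y where "y i = G a + real i / real M * (G b - G a)" for i
  have y: "y 0 = G a" "y M = G b" "\<And>i. y (Suc i) - y i = (G b - G a) / real M"
    using assms(4) by (auto simp: y_def field_simps)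
  have "\<exists>x\<ge>a. x \<le> b \<and> G x = y i" if "i \<le> M" for i
  proof (rule IVT')
    have "real i / real M \<in> {0..1}" using that assms(4) by (simp add: field_simps)
    then have "real i / real M * (G b - G a) \<le> 1 * (G b - G a)"
      using less by (intro mult_right_mono) auto
    then show "y i \<le> G b" by (simp add: y_def)
    show "G a \<le> y i" using less by (simp add: y_def)
  qed (use assms in auto)
  then obtain u where u: "\<And>i. i \<le> M \<Longrightarrow> a \<le> u i \<and> u i \<le> b \<and> G (u i) = y i"
    by metis
  \<comment> \<open>\<open>G\<close> may be flat near the ends, so the points found for the extreme
    values need not be \<open>a\<close> and \<open>b\<close>; these are put in by hand.\<close>
  define t where "t = (\<lambda>i. if i = 0 then a else if i = M then b else u i)"
  have t: "G (t i) = y i" if "i \<le> M" for i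
    using that u y by (auto simp: t_def)
  show ?thesis
  proof
    show "t 0 = a" "t M = b" using assms(4) by (auto simp: t_def)
    fix i assume i: "i < M"
    show diff: "G (t (Suc i)) - G (t i) = (G b - G a) / real M"
      using i by (simp add: t y)
    \<comment> \<open>Since \<open>G\<close> increases strictly along the points, its monotonicity
      forces the points into order.\<close>
    have "0 < (G b - G a) / real M" using less assms(4) by simp
    with diff have "G (t i) < G (t (Suc i))" by simp
    then show "t i \<le> t (Suc i)"
      using monoD[OF assms(3), of "t (Suc i)" "t i"] by force
  qed
qed

lemma grid_cell:
  fixes t :: "nat \<Rightarrow> real"
  assumes "0 < M" "t 0 \<le> x" "x \<le> t M"
  obtains i where "i < M" "t i \<le> x" "x \<le> t (Suc i)"
  using assms
proof (induction M arbitrary: thesis)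
  case (Suc M)
  show ?case
  proof (cases "t M \<le> x")
    case True
    then show ?thesis using Suc.prems by blast
  next
    case False
    then have "0 < M" using Suc.prems by (cases M) auto
    with False Suc show ?thesis by (metis less_SucI linear)
  qed
qed simp

text \<open>\<open>g x\<close> lies between the values of \<open>g\<close> at the ends of its cell,
  which are within \<open>\<eta>\<close> of those of \<open>f\<close>, and \<open>f\<close> changes
  by at most \<open>h\<close> in the cell. So \<open>g\<close> may be a step function.\<close>

lemma uniform_close_from_grid:
  fixes f g :: "real \<Rightarrow> real" and t :: "nat \<Rightarrow> real"
  assumes "mono f" "mono g" "0 < M" "x \<in> {t 0..t M}"
    and "\<And>i. i < M \<Longrightarrow> f (t (Suc i)) - f (t i) \<le> h"
    and "\<And>i. i \<le> M \<Longrightarrow> \<bar>g (t i) - f (t i)\<bar> \<le> \<eta>"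
  shows "\<bar>g x - f x\<bar> \<le> \<eta> + h"
proof -
  obtain i where i: "i < M" "t i \<le> x" "x \<le> t (Suc i)"
    using assms(3,4) by (auto intro: grid_cell)
  show ?thesis
    using monoD[OF assms(1) i(2)] monoD[OF assms(1) i(3)] monoD[OF assms(2) i(2)] monoD[OF assms(2) i(3)]
      assms(5)[OF i(1)] assms(6)[of i] assms(6)[of "Suc i"] i(1) by (simp add: abs_le_iff)
qed

text \<open>Summation by parts moves the differences onto the weights, whose total decrease is at
  most \<open>w 0\<close>; hence the bound is independent of the number of terms.\<close>

lemma sum_diff_mult_decreasing_le:
  fixes D w :: "nat \<Rightarrow> real"
  assumes D: "\<And>i. i \<le> N \<Longrightarrow> \<bar>D i\<bar> \<le> \<eta>"
    and w: "\<And>i. Suc i < N \<Longrightarrow> w (Suc i) \<le> w i" "\<And>i. i < N \<Longrightarrow> 0 \<le> w i" and "0 < N"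
  shows "(\<Sum>i<N. (D (Suc i) - D i) * w i) \<le> 2 * \<eta> * w 0"
proof -
  \<comment> \<open>The boundary term at \<open>n\<close> is kept so that the induction closes. Of
    the rest, \<open>\<eta> * w 0\<close> pays for \<open>- D 0 * w 0\<close> and
    \<open>\<eta> * (w 0 - w n)\<close> for the decrease of the weights so far.\<close>
  have "(\<Sum>i<Suc n. (D (Suc i) - D i) * w i) \<le> D (Suc n) * w n + \<eta> * (2 * w 0 - w n)"
    if "n < N" for n
    using that
  proof (induction n)
    case 0
    then have "- D 0 * w 0 \<le> \<eta> * w 0"
      using D[of 0] w(2)[of 0] by (intro mult_right_mono) auto
    then show ?case by (simp add: algebra_simps)
  next
    case (Suc n)
    then have "D (Suc n) * (w n - w (Suc n)) \<le> \<eta> * (w n - w (Suc n))"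
      using D[of "Suc n"] w(1)[of n] by (intro mult_right_mono) auto
    with Suc show ?case by (simp add: algebra_simps)
  qed
  moreover obtain n where n: "N = Suc n" using \<open>0 < N\<close> by (cases N) auto
  moreover have "D (Suc n) * w n \<le> \<eta> * w n"
    using D[of "Suc n"] w(2)[of n] n by (intro mult_right_mono) auto
  ultimately show ?thesis by (force simp: algebra_simps)
qed

text \<open>The difference of the left sum and the right sum splits in two. Changing the
  denominators costs \<open>\<kappa> / g\<^sup>2\<close>, because \<open>H\<close> has total
  increment at most 1; replacing \<open>H\<close> by \<open>K\<close> is handled by summation by
  parts with the decreasing weights \<open>1 / B\<close>.\<close>

lemma Riemann_sum_compare:
  fixes A B H K :: "nat \<Rightarrow> real"
  assumes "0 < N" "0 < g" "0 \<le> \<kappa>"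
    and lower: "\<And>i. i \<le> N \<Longrightarrow> g \<le> A i" "\<And>i. i \<le> N \<Longrightarrow> g \<le> B i"
    and mono: "\<And>i. i < N \<Longrightarrow> B i \<le> B (Suc i)" "\<And>i. i < N \<Longrightarrow> H i \<le> H (Suc i)"
    and mass: "H N - H 0 \<le> 1"
    and close: "\<And>i. i \<le> N \<Longrightarrow> \<bar>H i - K i\<bar> \<le> \<eta>" "\<And>i. i < N \<Longrightarrow> B (Suc i) - A i \<le> \<kappa>"
  shows "(\<Sum>i<N. (H (Suc i) - H i) / A i) - (\<Sum>i<N. (K (Suc i) - K i) / B (Suc i))
     \<le> \<kappa> / g\<^sup>2 + 2 * \<eta> / g"
proof -
  define D where "D i = H i - K i" for i
  have pos: "0 < A i" "0 < B i" if "i \<le> N" for i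
    using lower[OF that] \<open>0 < g\<close> by auto
  have "0 \<le> \<eta>" using close(1)[of 0] by simp
  have "(H (Suc i) - H i) / A i - (K (Suc i) - K i) / B (Suc i)
      \<le> (H (Suc i) - H i) * (\<kappa> / g\<^sup>2) + (D (Suc i) - D i) * (1 / B (Suc i))" if "i < N" for i
  proof -
    have "1 / A i - 1 / B (Suc i) = (B (Suc i) - A i) / (A i * B (Suc i))"
      using pos[of i] pos[of "Suc i"] that by (simp add: field_simps)
    also have "\<dots> \<le> \<kappa> / g\<^sup>2"
      unfolding power2_eq_square
      using close(2)[OF that] lower(1)[of i] lower(2)[of "Suc i"] that \<open>0 < g\<close> \<open>0 \<le> \<kappa>\<close>
      by (intro frac_le mult_mono) auto
    finally have "(H (Suc i) - H i) * (1 / A i - 1 / B (Suc i)) \<le> (H (Suc i) - H i) * (\<kappa> / g\<^sup>2)"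
      using mono(2)[OF that] by (intro mult_left_mono) auto
    then show ?thesis
      by (simp add: D_def algebra_simps add_divide_distrib diff_divide_distrib)
  qed
  then have "(\<Sum>i<N. (H (Suc i) - H i) / A i - (K (Suc i) - K i) / B (Suc i))
      \<le> (\<Sum>i<N. (H (Suc i) - H i) * (\<kappa> / g\<^sup>2) + (D (Suc i) - D i) * (1 / B (Suc i)))"
    by (intro sum_mono) auto
  also have "\<dots> = (H N - H 0) * (\<kappa> / g\<^sup>2) + (\<Sum>i<N. (D (Suc i) - D i) * (1 / B (Suc i)))"
    unfolding sum.distrib sum_distrib_right[symmetric] by (simp add: sum_lessThan_telescope)
  also have "(\<Sum>i<N. (D (Suc i) - D i) * (1 / B (Suc i))) \<le> 2 * \<eta> * (1 / B (Suc 0))"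
    using close(1) pos mono(1) \<open>0 < N\<close>
    by (intro sum_diff_mult_decreasing_le) (auto simp: D_def less_imp_le intro!: divide_left_mono mult_pos_pos)
  also have "2 * \<eta> * (1 / B (Suc 0)) \<le> 2 * \<eta> * (1 / g)"
    using lower(2)[of "Suc 0"] \<open>0 < N\<close> \<open>0 < g\<close> \<open>0 \<le> \<eta>\<close> by (intro mult_left_mono frac_le) auto
  also have "(H N - H 0) * (\<kappa> / g\<^sup>2) \<le> 1 * (\<kappa> / g\<^sup>2)"
    using mass \<open>0 \<le> \<kappa>\<close> by (intro mult_right_mono) auto
  finally show ?thesis by (simp add: sum_subtractf)
qed

text \<open>This is \<open>- dL = dH / G\<close> in finite form; \<open>L\<close> will be \<open>- ln F\<close>.\<close>

definition hazard_bounds ::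
    "(real \<Rightarrow> real) \<Rightarrow> (real \<Rightarrow> real) \<Rightarrow> (real \<Rightarrow> real) \<Rightarrow> real \<Rightarrow> real \<Rightarrow> bool" where
  "hazard_bounds G H L s t \<longleftrightarrow>
     (H t - H s) / G t \<le> L s - L t \<and> L s - L t \<le> (H t - H s) / G s"

lemma hazard_bounds_sums:
  assumes "\<And>i. i < N \<Longrightarrow> hazard_bounds G H L (t i) (t (Suc i))"
  shows "(\<Sum>i<N. (H (t (Suc i)) - H (t i)) / G (t (Suc i))) \<le> L (t 0) - L (t N)"
    and "L (t 0) - L (t N) \<le> (\<Sum>i<N. (H (t (Suc i)) - H (t i)) / G (t i))"
proof -
  have "L (t 0) - L (t N) = (\<Sum>i<N. L (t i) - L (t (Suc i)))"
    by (rule sum_lessThan_telescope'[symmetric])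
  then show "(\<Sum>i<N. (H (t (Suc i)) - H (t i)) / G (t (Suc i))) \<le> L (t 0) - L (t N)"
    "L (t 0) - L (t N) \<le> (\<Sum>i<N. (H (t (Suc i)) - H (t i)) / G (t i))"
    using assms by (auto simp: hazard_bounds_def intro!: sum_mono)
qed

text \<open>On a common grid, \<open>L x\<close> and \<open>L' x\<close> each lie between a right
  and a left Riemann sum. Comparing the left sum of one with the right sum of the other, in both
  directions, bounds their difference.\<close>

lemma cumulative_hazard_close:
  fixes G G' H H' L L' :: "real \<Rightarrow> real"
  assumes "x \<le> b" "continuous_on {x..b} G" "mono G" "mono G'" "mono H" "mono H'"
    and \<gamma>: "0 < \<gamma>" "\<gamma> \<le> 1" "\<gamma> \<le> G x" and \<eta>: "0 < \<eta>" "\<eta> \<le> \<gamma> / 2"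
    and mass: "G b - G x \<le> 1" "H b - H x \<le> 1" "H' b - H' x \<le> 1"
    and close: "\<And>y. y \<in> {x..b} \<Longrightarrow> \<bar>G' y - G y\<bar> \<le> \<eta>" "\<And>y. y \<in> {x..b} \<Longrightarrow> \<bar>H' y - H y\<bar> \<le> \<eta>"
    and hazard: "\<And>s t. x \<le> s \<Longrightarrow> s \<le> t \<Longrightarrow> t \<le> b \<Longrightarrow> hazard_bounds G H L s t"
      "\<And>s t. x \<le> s \<Longrightarrow> s \<le> t \<Longrightarrow> t \<le> b \<Longrightarrow> hazard_bounds G' H' L' s t"
    and L: "L b = 0" "L' b = 0"
  shows "\<bar>L' x - L x\<bar> \<le> 12 * \<eta> / \<gamma>\<^sup>2"
proof -
  \<comment> \<open>Enough cells for \<open>G\<close> to grow by at most \<open>\<eta>\<close> in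
    each; together with the error \<open>\<eta>\<close> of \<open>G'\<close> this gives the
    \<open>2 * \<eta>\<close> in the role of \<open>\<kappa>\<close> below.\<close>
  define M where "M = nat \<lceil>1 / \<eta>\<rceil>"
  have M: "0 < M" "1 / real M \<le> \<eta>"
  proof -
    have "1 / \<eta> \<le> real M" "0 < 1 / \<eta>" using \<eta>(1) by (auto simp: M_def)
    then show "0 < M" by (cases M) auto
    with \<open>1 / \<eta> \<le> real M\<close> show "1 / real M \<le> \<eta>" using \<eta>(1) by (simp add: field_simps)
  qed
  obtain t where t: "t 0 = x" "t M = b" "\<And>i. i < M \<Longrightarrow> t i \<le> t (Suc i)"
    "\<And>i. i < M \<Longrightarrow> G (t (Suc i)) - G (t i) = (G b - G x) / real M"
    using quantile_grid[OF assms(1-3) M(1)] by blast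
  have t_mono: "t i \<le> t j" if "i \<le> j" "j \<le> M" for i j
    using that
  proof (induction j rule: dec_induct)
    case (step n)
    then show ?case using t(3)[of n] by simp
  qed simp
  have t_in: "t i \<in> {x..b}" if "i \<le> M" for i
    using t_mono[of 0 i] t_mono[of i M] that by (simp add: t)
  have fine: "G (t (Suc i)) - G (t i) \<le> \<eta>" if "i < M" for i
  proof -
    have "(G b - G x) / real M \<le> 1 / real M"
      using mass(1) by (intro divide_right_mono) auto
    then show ?thesis using M(2) t(4)[OF that] by simp
  qed
  have G: "\<gamma> / 2 \<le> G (t i)" "\<gamma> / 2 \<le> G' (t i)" if "i \<le> M" for i
  proof -
    have "G x \<le> G (t i)" using t_in[OF that] by (intro monoD[OF \<open>mono G\<close>]) auto
    with \<gamma> show "\<gamma> / 2 \<le> G (t i)" by simp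
    show "\<gamma> / 2 \<le> G' (t i)"
      using \<open>G x \<le> G (t i)\<close> \<gamma> \<eta> close(1)[OF t_in[OF that]] by (simp add: abs_le_iff)
  qed
  have hz: "hazard_bounds G H L (t i) (t (Suc i))" "hazard_bounds G' H' L' (t i) (t (Suc i))"
    if "i < M" for i
    using t_in[of i] t_in[of "Suc i"] t(3)[OF that] that by (auto intro: hazard)
  \<comment> \<open>With \<open>g = \<gamma> / 2\<close> the error terms are
    \<open>8 * \<eta> / \<gamma>\<^sup>2\<close> and \<open>4 * \<eta> / \<gamma>\<close>, and
    \<open>\<gamma> \<le> 1\<close>.\<close>
  have arith: "2 * \<eta> / (\<gamma> / 2)\<^sup>2 + 2 * \<eta> / (\<gamma> / 2) \<le> 12 * \<eta> / \<gamma>\<^sup>2"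
  proof -
    have "1 / \<gamma> \<le> 1 / \<gamma>\<^sup>2"
      using \<gamma> by (intro divide_left_mono) (auto simp: power2_eq_square mult_le_one)
    then have "4 * \<eta> * (1 / \<gamma>) \<le> 4 * \<eta> * (1 / \<gamma>\<^sup>2)"
      using \<eta> by (intro mult_left_mono) auto
    then show ?thesis by (simp add: power_divide)
  qed
  have "L x - L' x \<le> (\<Sum>i<M. (H (t (Suc i)) - H (t i)) / G (t i))
      - (\<Sum>i<M. (H' (t (Suc i)) - H' (t i)) / G' (t (Suc i)))"
    using hazard_bounds_sums[of M G H L t] hazard_bounds_sums[of M G' H' L' t] hz L by (simp add: t)
  also have "\<dots> \<le> 2 * \<eta> / (\<gamma> / 2)\<^sup>2 + 2 * \<eta> / (\<gamma> / 2)"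
  proof (rule Riemann_sum_compare)
    fix i assume i: "i < M"
    show "G' (t (Suc i)) - G (t i) \<le> 2 * \<eta>"
      using fine[OF i] close(1)[OF t_in, of "Suc i"] i by (simp add: abs_le_iff)
  qed (use M G \<gamma> \<eta> mass t monoD[OF \<open>mono G'\<close>] monoD[OF \<open>mono H\<close>] close(2)[OF t_in] in
      \<open>auto simp: abs_minus_commute\<close>)
  finally have 1: "L x - L' x \<le> 12 * \<eta> / \<gamma>\<^sup>2" using arith by simp
  have "L' x - L x \<le> (\<Sum>i<M. (H' (t (Suc i)) - H' (t i)) / G' (t i))
      - (\<Sum>i<M. (H (t (Suc i)) - H (t i)) / G (t (Suc i)))"
    using hazard_bounds_sums[of M G H L t] hazard_bounds_sums[of M G' H' L' t] hz L by (simp add: t)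
  also have "\<dots> \<le> 2 * \<eta> / (\<gamma> / 2)\<^sup>2 + 2 * \<eta> / (\<gamma> / 2)"
  proof (rule Riemann_sum_compare)
    fix i assume i: "i < M"
    show "G (t (Suc i)) - G' (t i) \<le> 2 * \<eta>"
      using fine[OF i] close(1)[OF t_in, of i] i by (simp add: abs_le_iff)
  qed (use M G \<gamma> \<eta> mass t monoD[OF \<open>mono G\<close>] monoD[OF \<open>mono H'\<close>] close(2)[OF t_in] in auto)
  finally have 2: "L' x - L x \<le> 12 * \<eta> / \<gamma>\<^sup>2" using arith by simp
  from 1 2 show ?thesis by (simp add: abs_le_iff)
qed

lemma ln_diff_bounds:
  fixes a b :: real
  assumes "0 < a" "0 < b"
  shows "(b - a) / b \<le> ln b - ln a" "ln b - ln a \<le> (b - a) / a"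
  using ln_le_minus_one[of "b / a"] ln_le_minus_one[of "a / b"] assms
  by (simp_all add: ln_div field_simps)

text \<open>The slope of \<open>ln\<close> is at least 1 on \<open>{0<..1}\<close>, so closeness of
  the logarithms carries over to the values.\<close>

lemma abs_diff_le_abs_ln_diff:
  fixes a b :: real
  assumes "a \<in> {0<..1}" "b \<in> {0<..1}"
  shows "\<bar>a - b\<bar> \<le> \<bar>ln a - ln b\<bar>"
proof -
  have *: "v - u \<le> ln v - ln u" if "u \<in> {0<..1}" "v \<in> {0<..1}" "u \<le> v" for u v :: real
  proof -
    have "(v - u) * v \<le> (v - u) * 1" using that by (intro mult_left_mono) auto
    then have "v - u \<le> (v - u) / v" using that by (simp add: field_simps)
    with ln_diff_bounds(1)[of u v] that show ?thesis by auto
  qed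
  show ?thesis using *[of a b] *[of b a] assms by (cases "a \<le> b") auto
qed

section \<open>Empirical probabilities and the hazard of the product estimator\<close>

definition empirical :: "nat \<Rightarrow> (nat \<Rightarrow> 'a) \<Rightarrow> 'a set \<Rightarrow> real" where
  "empirical n S A = real (card {j. j < n \<and> S j \<in> A}) / real n"

lemma empirical_mono: "A \<subseteq> B \<Longrightarrow> empirical n S A \<le> empirical n S B"
  unfolding empirical_def by (intro divide_right_mono of_nat_mono card_mono) auto

lemma empirical_bounds: "0 \<le> empirical n S A" "empirical n S A \<le> 1"
proof -
  have "card {j. j < n \<and> S j \<in> A} \<le> card {..<n}" by (intro card_mono) auto
  then show "empirical n S A \<le> 1" by (simp add: empirical_def divide_le_eq)
qed (simp add: empirical_def)

lemma card_eq_empirical: "real (card {j. j < n \<and> S j \<in> A}) = real n * empirical n S A"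
  by (auto simp: empirical_def)

abbreviation bids_upto :: "real \<Rightarrow> (real \<times> nat) set" where
  "bids_upto y \<equiv> {..y} \<times> UNIV"

abbreviation wins_upto :: "nat \<Rightarrow> real \<Rightarrow> (real \<times> nat) set" where
  "wins_upto i y \<equiv> {..y} \<times> {i}"

text \<open>A factor \<open>(r - 1) / r\<close> contributes \<open>ln r - ln (r - 1)\<close>, which
  lies between \<open>1 / r\<close> and \<open>1 / (r - 1)\<close>. For a bid in
  \<open>{s<..t}\<close>, \<open>r\<close> is at most \<open>n\<close> times the empirical
  \<open>G\<close> at \<open>t\<close>, and \<open>r - 1\<close> is at least \<open>n\<close> times
  that at \<open>s\<close>.\<close>

lemma kaplan_meier_hazard:
  assumes s: "0 < empirical n S (bids_upto s)" and "s \<le> t"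
  shows "0 < kaplan_meier n S i s"
    and "hazard_bounds (\<lambda>y. empirical n S (bids_upto y)) (\<lambda>y. empirical n S (wins_upto i y))
      (\<lambda>y. - ln (kaplan_meier n S i y)) s t"
proof -
  let ?G = "\<lambda>y. empirical n S (bids_upto y)" and ?H = "\<lambda>y. empirical n S (wins_upto i y)"
  have n: "0 < n" using s by (cases n) (auto simp: empirical_def)
  have rank_eq: "real (bid_rank n S j) = real n * ?G (fst (S j))" for j
    unfolding card_eq_empirical[symmetric] bid_rank_def by (simp add: mem_Times_iff)
  \<comment> \<open>The \<open>+ 1\<close> is the bid \<open>j\<close> itself, which counts towards
    its rank but lies above \<open>s\<close>. It makes every rank exceed 1, so that all logarithms
    are defined.\<close>
  have rank_gt: "real n * ?G s + 1 \<le> real (bid_rank n S j)" if "j < n" "s < fst (S j)" for j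
  proof -
    have "insert j {l. l < n \<and> fst (S l) \<le> s} \<subseteq> {l. l < n \<and> fst (S l) \<le> fst (S j)}"
      using that by auto
    then have "card (insert j {l. l < n \<and> fst (S l) \<le> s}) \<le> bid_rank n S j"
      unfolding bid_rank_def by (intro card_mono) auto
    moreover have "card (insert j {l. l < n \<and> fst (S l) \<le> s}) = Suc (card {l. l < n \<and> S l \<in> bids_upto s})"
      using that by (simp add: mem_Times_iff)
    ultimately show ?thesis
      unfolding card_eq_empirical[symmetric] by linarith
  qed
  have nG: "0 < real n * ?G s" using n s by simp
  have factor_pos: "0 < 1 - 1 / real (bid_rank n S j)" if "j < n" "s < fst (S j)" for j
    using rank_gt[OF that] nG by simp
  show pos_s: "0 < kaplan_meier n S i s"
    unfolding kaplan_meier_def by (intro prod_pos) (use factor_pos in auto)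
  have pos_t: "0 < kaplan_meier n S i t"
    using pos_s mono_kaplan_meier[OF \<open>s \<le> t\<close>] by (rule less_le_trans)
  define D where "D = {j. j < n \<and> snd (S j) = i \<and> s < fst (S j) \<and> fst (S j) \<le> t}"
  have D: "finite D" by (simp add: D_def)
  have "kaplan_meier n S i s = kaplan_meier n S i t * (\<Prod>j\<in>D. 1 - 1 / real (bid_rank n S j))"
    unfolding kaplan_meier_def D_def
    by (subst prod.union_disjoint[symmetric]) (use \<open>s \<le> t\<close> in \<open>auto intro!: prod.cong\<close>)
  then have "ln (kaplan_meier n S i s) = ln (kaplan_meier n S i t) + ln (\<Prod>j\<in>D. 1 - 1 / real (bid_rank n S j))"
    using pos_t pos_s by (simp add: ln_mult zero_less_mult_iff)
  also have "ln (\<Prod>j\<in>D. 1 - 1 / real (bid_rank n S j)) = (\<Sum>j\<in>D. ln (1 - 1 / real (bid_rank n S j)))"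
  proof (rule ln_prod)
    fix j assume "j \<in> D"
    then have "0 < 1 - 1 / real (bid_rank n S j)"
      using factor_pos by (simp only: D_def mem_Collect_eq)
    then show "1 - 1 / real (bid_rank n S j) \<noteq> 0" by (rule less_imp_neq[symmetric])
  qed (rule D)
  finally have diff: "- ln (kaplan_meier n S i s) - - ln (kaplan_meier n S i t) =
      (\<Sum>j\<in>D. - ln (1 - 1 / real (bid_rank n S j)))"
    by (simp add: sum_negf)
  have "{j. j < n \<and> S j \<in> wins_upto i t} = {j. j < n \<and> S j \<in> wins_upto i s} \<union> D"
    using \<open>s \<le> t\<close> by (auto simp: D_def mem_Times_iff)
  moreover have "{j. j < n \<and> S j \<in> wins_upto i s} \<inter> D = {}"
    by (auto simp: D_def mem_Times_iff)
  ultimately have "card {j. j < n \<and> S j \<in> wins_upto i t} = card {j. j < n \<and> S j \<in> wins_upto i s} + card D"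
    using D by (simp add: card_Un_disjoint)
  then have "real (card D) = real n * (?H t - ?H s)"
    unfolding right_diff_distrib card_eq_empirical[symmetric] by linarith
  then have card_D: "(?H t - ?H s) / g = (\<Sum>j\<in>D. 1 / (real n * g))" for g
    using n by simp
  have "1 / (real n * ?G t) \<le> - ln (1 - 1 / real (bid_rank n S j)) \<and>
      - ln (1 - 1 / real (bid_rank n S j)) \<le> 1 / (real n * ?G s)" if "j \<in> D" for j
  proof -
    let ?r = "real (bid_rank n S j)"
    have j: "j < n" "s < fst (S j)" "fst (S j) \<le> t" using that by (auto simp: D_def)
    have r: "real n * ?G s + 1 \<le> ?r" using rank_gt j by blast
    have "?G (fst (S j)) \<le> ?G t" using j by (intro empirical_mono) auto
    then have "?r \<le> real n * ?G t" unfolding rank_eq by (intro mult_left_mono) auto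
    then have "1 / (real n * ?G t) \<le> 1 / ?r" using r nG by (intro frac_le) linarith+
    moreover have "1 / (?r - 1) \<le> 1 / (real n * ?G s)" using r nG by (intro frac_le) linarith+
    moreover have "1 - 1 / ?r = (?r - 1) / ?r" using r nG by (simp add: field_simps)
    then have "- ln (1 - 1 / ?r) = ln ?r - ln (?r - 1)" using r nG by (simp add: ln_div)
    moreover have "1 / ?r \<le> ln ?r - ln (?r - 1)" "ln ?r - ln (?r - 1) \<le> 1 / (?r - 1)"
      using ln_diff_bounds[of "?r - 1" ?r] r nG by auto
    ultimately show ?thesis by linarith
  qed
  then show "hazard_bounds ?G ?H (\<lambda>y. - ln (kaplan_meier n S i y)) s t"
    unfolding hazard_bounds_def diff card_D by (intro conjI sum_mono) simp_all
qed

section \<open>The law of the auction and its samples\<close>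

lemma is_cdf_interval_measure:
  assumes "is_cdf f"
  shows "real_distribution (interval_measure f)" "cdf (interval_measure f) = f"
proof -
  from assms obtain M where M: "real_distribution M" "f = cdf M"
    by (auto simp: is_cdf_def)
  interpret real_distribution M by fact
  have f: "\<And>x y. x \<le> y \<Longrightarrow> f x \<le> f y" "\<And>a. continuous (at_right a) f"
    "(f \<longlongrightarrow> 0) at_bot" "(f \<longlongrightarrow> 1) at_top"
    unfolding M(2) by (rule cdf_nondecreasing cdf_is_right_cont cdf_lim_at_bot cdf_lim_at_top_prob | assumption)+
  from real_distribution_interval_measure[OF f] show "real_distribution (interval_measure f)" .
  from cdf_interval_measure[OF f(1-3)] show "cdf (interval_measure f) = f" .
qed

lemma is_cdf_mono: "is_cdf f \<Longrightarrow> mono f"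
  by (metis finite_borel_measure.cdf_nondecreasing is_cdf_interval_measure monoI
      real_distribution.finite_borel_measure_M)

lemma is_cdf_bounds:
  assumes "is_cdf f"
  shows "0 \<le> f x" "f x \<le> 1"
  using assms unfolding is_cdf_def
  by (auto simp: finite_borel_measure.cdf_nonneg real_distribution.finite_borel_measure_M
      real_distribution.cdf_bounded_prob)

lemma measure_interval_measure_cdf:
  assumes "is_cdf f"
  shows "measure (interval_measure f) {..x} = f x"
    and "x \<le> y \<Longrightarrow> measure (interval_measure f) {x<..y} = f y - f x"
proof -
  interpret real_distribution "interval_measure f"
    by (rule is_cdf_interval_measure[OF assms])
  show eq: "measure (interval_measure f) {..x} = f x" for x
    using is_cdf_interval_measure(2)[OF assms] by (metis cdf_def)
  assume "x \<le> y"
  then have "{x<..y} = {..y} - {..x}" by auto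
  then show "measure (interval_measure f) {x<..y} = f y - f x"
    using \<open>x \<le> y\<close> by (simp add: finite_measure_Diff eq)
qed

lemma measure_PiM_PiE:
  assumes "finite I" "\<And>i. i \<in> I \<Longrightarrow> prob_space (M i)" "\<And>i. i \<in> I \<Longrightarrow> A i \<in> sets (M i)"
  shows "measure (PiM I M) (PiE I A) = (\<Prod>i\<in>I. measure (M i) (A i))"
proof -
  \<comment> \<open>The product locale asks for a probability space at every index; outside
    \<open>I\<close> a one-point space fills in.\<close>
  define M' where "M' i = (if i \<in> I then M i else count_space {undefined})" for i
  interpret M': prob_space "M' i" for i
    using assms(2) by (cases "i \<in> I") (auto simp: M'_def intro!: prob_spaceI)
  interpret finite_product_prob_space M' I
    by unfold_locales (rule assms(1))
  have "measure (PiM I M') (PiE I A) = (\<Prod>i\<in>I. measure (M' i) (A i))"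
    using assms(3) by (intro prob_times) (simp add: M'_def)
  moreover have "PiM I M' = PiM I M"
    by (rule PiM_cong) (auto simp: M'_def)
  ultimately show ?thesis by (simp add: M'_def)
qed

section \<open>The joint law of the highest bid and the winner\<close>

locale auction =
  fixes k :: nat and F :: "nat \<Rightarrow> real \<Rightarrow> real"
  assumes k_ge_2: "2 \<le> k" and cdf: "\<And>i. i \<in> {1..k} \<Longrightarrow> is_cdf (F i)"
begin

definition bids :: "(nat \<Rightarrow> real) measure" where
  "bids = (\<Pi>\<^sub>M i\<in>{1..k}. interval_measure (F i))"

abbreviation law :: "(real \<times> nat) measure" where
  "law \<equiv> first_price_auction k F"

lemma prob_space_interval_measure: "i \<in> {1..k} \<Longrightarrow> prob_space (interval_measure (F i))"
  using is_cdf_interval_measure(1)[OF cdf] by (simp add: real_distribution_def)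

lemma prob_space_bids: "prob_space bids"
  unfolding bids_def by (intro prob_space_PiM prob_space_interval_measure)

lemma space_bids: "space bids = PiE {1..k} (\<lambda>_. UNIV)"
  by (simp add: bids_def space_PiM)

lemma measure_bids_PiE:
  "(\<And>i. i \<in> {1..k} \<Longrightarrow> A i \<in> sets borel) \<Longrightarrow>
     measure bids (PiE {1..k} A) = (\<Prod>i\<in>{1..k}. measure (interval_measure (F i)) (A i))"
  unfolding bids_def by (intro measure_PiM_PiE prob_space_interval_measure) auto

lemma auction_outcome_measurable [measurable]:
  "auction_outcome k \<in> bids \<rightarrow>\<^sub>M borel \<Otimes>\<^sub>M count_space UNIV"
proof -
  have comp: "(\<lambda>X. X i) \<in> borel_measurable bids" if "i \<in> {1..k}" for i
  proof -
    have "(\<lambda>X. X i) \<in> bids \<rightarrow>\<^sub>M interval_measure (F i)"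
      unfolding bids_def by (rule measurable_component_singleton[OF that])
    then show ?thesis by (simp cong: measurable_cong_sets)
  qed
  then have Max: "(\<lambda>X. Max (X ` {1..k})) \<in> borel_measurable bids"
    using borel_measurable_Max[of "{1..k}" "\<lambda>i X. X i" bids] by simp
  have "Measurable.pred bids (\<lambda>X. i \<in> {1..k} \<and> X i = Max (X ` {1..k}))" for i
  proof (cases "i \<in> {1..k}")
    case True
    then show ?thesis
      using borel_measurable_eq[OF comp[OF True] Max] by (simp add: pred_def)
  next
    case False
    then show ?thesis by (simp only: simp_thms) simp
  qed
  then have "(\<lambda>X. LEAST i. i \<in> {1..k} \<and> X i = Max (X ` {1..k})) \<in> bids \<rightarrow>\<^sub>M count_space UNIV"
    by (rule measurable_Least)
  with Max show ?thesis
    unfolding auction_outcome_def[abs_def] by (rule measurable_Pair)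
qed

lemma sets_law [measurable_cong]: "sets law = sets (borel \<Otimes>\<^sub>M count_space UNIV)"
  by (simp add: first_price_auction_def)

lemma space_law: "space law = UNIV"
  by (simp add: first_price_auction_def space_pair_measure)

lemma prob_space_law: "prob_space law"
  using prob_space.prob_space_distr[OF prob_space_bids auction_outcome_measurable]
  by (simp add: first_price_auction_def bids_def)

lemma Times_in_sets_law: "A \<in> sets borel \<Longrightarrow> A \<times> B \<in> sets law"
  by (simp add: sets_law pair_measureI)

lemma measure_law:
  "E \<in> sets law \<Longrightarrow> measure law E = measure bids {X \<in> space bids. auction_outcome k X \<in> E}"
  unfolding first_price_auction_def
  using auction_outcome_measurable
  by (subst measure_distr) (auto simp: bids_def vimage_def Int_def conj_commute first_price_auction_def)

lemma auction_outcome_in_bids_upto: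
  "auction_outcome k X \<in> bids_upto y \<longleftrightarrow> (\<forall>j\<in>{1..k}. X j \<le> y)"
  using k_ge_2 by (simp add: auction_outcome_def)

definition G :: "real \<Rightarrow> real" where "G y = (\<Prod>i\<in>{1..k}. F i y)"

definition H :: "nat \<Rightarrow> real \<Rightarrow> real" where "H i y = measure law (wins_upto i y)"

lemma measure_bids_upto: "measure law (bids_upto y) = G y"
proof -
  have "measure law (bids_upto y) = measure bids (PiE {1..k} (\<lambda>_. {..y}))"
    unfolding measure_law[OF Times_in_sets_law[of "{..y}"], simplified] auction_outcome_in_bids_upto
    by (intro arg_cong[where f="measure bids"]) (auto simp: space_bids PiE_iff extensional_def)
  also have "\<dots> = (\<Prod>i\<in>{1..k}. measure (interval_measure (F i)) {..y})"
    by (rule measure_bids_PiE) simp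
  also have "\<dots> = G y"
    unfolding G_def by (intro prod.cong refl measure_interval_measure_cdf(1) cdf)
  finally show ?thesis .
qed

lemma mono_G: "mono G"
proof (rule monoI)
  fix x y :: real assume "x \<le> y"
  then show "G x \<le> G y" unfolding G_def
    by (intro prod_mono conjI is_cdf_bounds cdf monoD[OF is_cdf_mono[OF cdf]])
qed

lemma mono_H: "mono (H i)"
proof -
  interpret prob_space law by (rule prob_space_law)
  show ?thesis
    by (rule monoI, unfold H_def, rule finite_measure_mono) (auto intro: Times_in_sets_law)
qed

lemma H_increment: "s \<le> t \<Longrightarrow> H i t - H i s = measure law ({s<..t} \<times> {i})"
proof -
  assume "s \<le> t"
  interpret prob_space law by (rule prob_space_law)
  have "{s<..t} \<times> {i} = wins_upto i t - wins_upto i s" by auto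
  then show ?thesis
    unfolding H_def using \<open>s \<le> t\<close>
    by (simp add: finite_measure_Diff Times_in_sets_law Sigma_mono)
qed

text \<open>A grid on which \<open>G\<close> has small increments is thereby fine enough for each
  \<open>H i\<close> too.\<close>

lemma H_increment_le_G: "s \<le> t \<Longrightarrow> H i t - H i s \<le> G t - G s"
proof -
  assume "s \<le> t"
  interpret prob_space law by (rule prob_space_law)
  have "G t - G s = measure law (bids_upto t - bids_upto s)"
    unfolding measure_bids_upto[symmetric] using \<open>s \<le> t\<close>
    by (subst finite_measure_Diff) (auto intro: Times_in_sets_law)
  also have "\<dots> \<ge> measure law ({s<..t} \<times> {i})"
    by (intro finite_measure_mono sets.Diff) (auto intro: Times_in_sets_law)
  finally show ?thesis using H_increment[OF \<open>s \<le> t\<close>] by simp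
qed

text \<open>Bidder \<open>i\<close> wins with a bid in \<open>(s, t]\<close> if all the others bid at most \<open>s\<close>, and only if
  they bid at most \<open>t\<close>. Neither direction depends on how ties are broken.\<close>

lemma H_increment_bounds:
  assumes "i \<in> {1..k}" "s \<le> t"
  shows "(F i t - F i s) * (\<Prod>j\<in>{1..k} - {i}. F j s) \<le> H i t - H i s"
    and "H i t - H i s \<le> (F i t - F i s) * (\<Prod>j\<in>{1..k} - {i}. F j t)"
proof -
  interpret prob_space bids by (rule prob_space_bids)
  define W where "W = {X \<in> space bids. auction_outcome k X \<in> {s<..t} \<times> {i}}"
  \<comment> \<open>\<open>R s\<close> and \<open>R t\<close> are boxes, so their probabilities
    factorise; \<open>W\<close> is caught between them.\<close>
  define R where "R y = PiE {1..k} (\<lambda>j. if j = i then {s<..t} else {..y})" for y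
  have W: "W \<in> sets bids"
    unfolding W_def using auction_outcome_measurable
    by (rule measurable_sets_Collect) (simp add: pair_measureI)
  have R: "R y \<in> sets bids" for y
    unfolding R_def bids_def by (rule sets_PiM_I_finite) auto
  have measure_R: "measure bids (R y) = (F i t - F i s) * (\<Prod>j\<in>{1..k} - {i}. F j y)" for y
  proof -
    have "measure bids (R y) = (\<Prod>j\<in>{1..k}. if j = i then F i t - F i s else F j y)"
      unfolding R_def using assms cdf
      by (subst measure_bids_PiE) (auto intro!: prod.cong simp: measure_interval_measure_cdf)
    also have "\<dots> = (F i t - F i s) * (\<Prod>j\<in>{1..k} - {i}. F j y)"
      using assms(1) by (subst prod.remove[of _ i]) (auto intro!: prod.cong)
    finally show ?thesis .
  qed
  have HW: "H i t - H i s = measure bids W"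
    unfolding H_increment[OF assms(2)] W_def by (rule measure_law) (simp add: Times_in_sets_law)
  have "R s \<subseteq> W"
  proof
    fix X assume X: "X \<in> R s"
    have mem: "X j \<in> (if j = i then {s<..t} else {..s})" if "j \<in> {1..k}" for j
      using X that unfolding R_def by (rule PiE_mem)
    have Xi: "s < X i" "X i \<le> t" using mem[OF assms(1)] by auto
    have Xj: "X j \<le> s" if "j \<in> {1..k}" "j \<noteq> i" for j
      using mem[OF that(1)] that(2) by simp
    have Max: "Max (X ` {1..k}) = X i"
      using Xi Xj assms(1) by (intro Max_eqI) (auto, metis atLeastAtMost_iff less_imp_le order.trans order_refl)
    have "(LEAST j. j \<in> {1..k} \<and> X j = Max (X ` {1..k})) = i"
      unfolding Max
    proof (rule Least_equality)
      fix j assume "j \<in> {1..k} \<and> X j = X i"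
      then show "i \<le> j" using Xj[of j] Xi by (cases "j = i") auto
    qed (use assms(1) in simp)
    moreover have "X \<in> space bids" using X by (auto simp: R_def space_bids PiE_iff)
    ultimately show "X \<in> W" using Max Xi by (simp add: W_def auction_outcome_def)
  qed
  then show "(F i t - F i s) * (\<Prod>j\<in>{1..k} - {i}. F j s) \<le> H i t - H i s"
    unfolding HW measure_R[symmetric] by (intro finite_measure_mono W)
  have "W \<subseteq> R t"
  proof
    fix X assume X: "X \<in> W"
    let ?P = "\<lambda>j. j \<in> {1..k} \<and> X j = Max (X ` {1..k})"
    have "Max (X ` {1..k}) \<in> X ` {1..k}"
      using k_ge_2 by (intro Max_in) auto
    then have "\<exists>j. ?P j" by auto
    then have "?P (LEAST j. ?P j)" by (rule LeastI_ex)
    then have "X i = Max (X ` {1..k})"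
      using X by (simp add: W_def auction_outcome_def)
    then have "s < X i" "X i \<le> t" "\<forall>j\<in>{1..k}. X j \<le> t"
      using X k_ge_2 by (auto simp: W_def auction_outcome_def)
    then show "X \<in> R t" using X by (auto simp: W_def R_def space_bids PiE_iff)
  qed
  then show "H i t - H i s \<le> (F i t - F i s) * (\<Prod>j\<in>{1..k} - {i}. F j t)"
    unfolding HW measure_R[symmetric] by (intro finite_measure_mono R)
qed

lemma G_split: "i \<in> {1..k} \<Longrightarrow> G y = F i y * (\<Prod>j\<in>{1..k} - {i}. F j y)"
  unfolding G_def by (rule prod.remove) auto

lemma F_pos: "i \<in> {1..k} \<Longrightarrow> 0 < G y \<Longrightarrow> 0 < F i y"
  using G_split[of i y] is_cdf_bounds(1)[OF cdf, of i y] by (cases "F i y = 0") auto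

text \<open>Since \<open>G\<close> is \<open>F i\<close> times the product \<open>P\<close> of the
  other CDFs, dividing by \<open>G\<close> at the same point cancels \<open>P\<close>. What remains
  are the relative increments of \<open>F i\<close>, which bracket the increment of
  \<open>ln (F i y)\<close>.\<close>

lemma hazard_bounds_law:
  assumes i: "i \<in> {1..k}" and "0 < G s" "s \<le> t"
  shows "hazard_bounds G (H i) (\<lambda>y. - ln (F i y)) s t"
proof -
  have "0 < G t" using monoD[OF mono_G \<open>s \<le> t\<close>] \<open>0 < G s\<close> by simp
  define P where "P y = (\<Prod>j\<in>{1..k} - {i}. F j y)" for y
  have G: "G y = F i y * P y" for y unfolding P_def by (rule G_split[OF i])
  have pos: "0 < F i s" "0 < F i t"
    using F_pos[OF i] \<open>0 < G s\<close> \<open>0 < G t\<close> by auto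
  then have P: "0 < P s" "0 < P t"
    using \<open>0 < G s\<close> \<open>0 < G t\<close> by (auto simp: G zero_less_mult_iff)
  have "(H i t - H i s) / G t \<le> ((F i t - F i s) * P t) / G t"
    using H_increment_bounds(2)[OF i \<open>s \<le> t\<close>] \<open>0 < G t\<close>
    by (intro divide_right_mono) (auto simp: P_def)
  also have "\<dots> = (F i t - F i s) / F i t" using P by (simp add: G)
  also have "\<dots> \<le> ln (F i t) - ln (F i s)" using pos by (rule ln_diff_bounds)
  finally have 1: "(H i t - H i s) / G t \<le> ln (F i t) - ln (F i s)" .
  have "ln (F i t) - ln (F i s) \<le> (F i t - F i s) / F i s" using pos by (rule ln_diff_bounds)
  also have "\<dots> = ((F i t - F i s) * P s) / G s" using P by (simp add: G)
  also have "\<dots> \<le> (H i t - H i s) / G s"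
    using H_increment_bounds(1)[OF i \<open>s \<le> t\<close>] \<open>0 < G s\<close>
    by (intro divide_right_mono) (auto simp: P_def)
  finally show ?thesis using 1 by (simp add: hazard_bounds_def)
qed

end

text \<open>Hoeffding's inequality for the indicators of \<open>E\<close> at the
  coordinates.\<close>

lemma empirical_deviation:
  assumes M: "prob_space M" and E: "E \<in> sets M" and "0 \<le> \<epsilon>" "0 < n"
  shows "measure (PiM {..<n} (\<lambda>_. M)) {S \<in> space (PiM {..<n} (\<lambda>_. M)).
     \<epsilon> \<le> \<bar>empirical n S E - measure M E\<bar>} \<le> 2 * exp (- 2 * real n * \<epsilon>\<^sup>2)"
proof -
  let ?P = "PiM {..<n} (\<lambda>_. M)"
  interpret M: prob_space M by fact
  interpret product_prob_space "\<lambda>_. M" "{..<n}" by unfold_locales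
  have comp: "(\<lambda>S. S j) \<in> ?P \<rightarrow>\<^sub>M M" if "j < n" for j
    using that by (intro measurable_component_singleton) auto
  have ind: "(\<lambda>S. indicator E (S j) :: real) \<in> borel_measurable ?P" if "j < n" for j
    using comp[OF that] E by measurable
  have distr_comp: "distr ?P M (\<lambda>S. S j) = M" if "j < n" for j
    using that by (intro PiM_component) auto
  have mean: "P.expectation (\<lambda>S. indicator E (S j) :: real) = measure M E" if "j < n" for j
  proof -
    have "P.expectation (\<lambda>S. indicator E (S j) :: real) = (\<integral>x. indicator E x \<partial>distr ?P M (\<lambda>S. S j))"
      using E comp[OF that] by (subst integral_distr) auto
    then show ?thesis using E by (simp add: distr_comp[OF that] Int_absorb2 sets.sets_into_space)
  qed
  \<comment> \<open>The coordinates are independent because their joint law is the product measure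
    itself.\<close>
  have proj: "P.indep_vars (\<lambda>_. M) (\<lambda>j S. S j) {..<n}"
  proof (subst P.indep_vars_iff_distr_eq_PiM')
    have "distr ?P ?P (\<lambda>S. \<lambda>j\<in>{..<n}. S j) = distr ?P ?P (\<lambda>S. S)"
      by (intro distr_cong) (auto simp: space_PiM)
    also have "\<dots> = PiM {..<n} (\<lambda>j. distr ?P M (\<lambda>S. S j))"
      unfolding distr_id by (rule PiM_cong) (simp_all add: distr_comp)
    finally show "distr ?P ?P (\<lambda>S. \<lambda>j\<in>{..<n}. S j) = PiM {..<n} (\<lambda>j. distr ?P M (\<lambda>S. S j))" .
  qed (use \<open>0 < n\<close> comp in auto)
  have indep: "P.indep_vars (\<lambda>_. borel) (\<lambda>j S. indicator E (S j) :: real) {..<n}"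
    using P.indep_vars_compose2[OF proj, of "\<lambda>_. indicator E" "\<lambda>_. borel"] E by simp
  interpret Hoeffding_ineq ?P "{..<n}" "\<lambda>j S. indicator E (S j)" "\<lambda>_. 0" "\<lambda>_. 1" "real n * measure M E"
  proof unfold_locales
    show "real n * measure M E \<equiv> \<Sum>j<n. P.expectation (\<lambda>S. indicator E (S j))"
      by (rule eq_reflection) (simp add: mean)
  qed (use indep in \<open>auto simp: indicator_def\<close>)
  have "card {j. j < n \<and> S j \<in> E} = (\<Sum>j<n. indicator E (S j) :: real)" for S
    by (simp add: indicator_def sum.If_cases Int_def)
  then have "\<epsilon> \<le> \<bar>empirical n S E - measure M E\<bar> \<longleftrightarrow>
      \<epsilon> * real n \<le> \<bar>(\<Sum>j<n. indicator E (S j)) - real n * measure M E\<bar>" for S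
  proof -
    assume eq: "card {j. j < n \<and> S j \<in> E} = (\<Sum>j<n. indicator E (S j) :: real)" for S
    have "\<bar>(\<Sum>j<n. indicator E (S j)) - real n * measure M E\<bar> = real n * \<bar>empirical n S E - measure M E\<bar>"
      unfolding eq[symmetric] card_eq_empirical right_diff_distrib[symmetric] by (simp add: abs_mult)
    then show ?thesis using \<open>0 < n\<close> by (simp add: mult.commute)
  qed
  \<comment> \<open>A deviation \<open>\<epsilon>\<close> of the mean is a deviation
    \<open>\<epsilon> * real n\<close> of the sum, and the squared ranges add up to
    \<open>n\<close>.\<close>
  then have "P.prob {S \<in> space ?P. \<epsilon> \<le> \<bar>empirical n S E - measure M E\<bar>} \<le>
      2 * exp (- 2 * (\<epsilon> * real n)\<^sup>2 / (\<Sum>j<n. (1 - 0)\<^sup>2))"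
    using Hoeffding_ineq_abs_ge[of "\<epsilon> * real n"] \<open>0 \<le> \<epsilon>\<close> \<open>0 < n\<close> by simp
  also have "- 2 * (\<epsilon> * real n)\<^sup>2 / (\<Sum>j<n. (1 - 0)\<^sup>2) = - 2 * real n * \<epsilon>\<^sup>2"
    using \<open>0 < n\<close> by (simp add: power2_eq_square)
  finally show ?thesis .
qed

section \<open>Accuracy of the estimator\<close>

lemma kaplan_meier_measurable:
  assumes M: "sets M = sets (borel \<Otimes>\<^sub>M count_space UNIV)"
  shows "(\<lambda>S. kaplan_meier n S i x) \<in> borel_measurable (PiM {..<n} (\<lambda>_. M))"
proof -
  let ?P = "PiM {..<n} (\<lambda>_. M)"
  have comp: "(\<lambda>S. S j) \<in> ?P \<rightarrow>\<^sub>M borel \<Otimes>\<^sub>M count_space UNIV" if "j < n" for j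
    using measurable_component_singleton[of j "{..<n}" "\<lambda>_. M"] that M
    by (simp cong: measurable_cong_sets)
  have [measurable]: "(\<lambda>S. fst (S j)) \<in> borel_measurable ?P" if "j < n" for j
    using comp[OF that] by measurable
  have [measurable]: "(\<lambda>S. snd (S j)) \<in> ?P \<rightarrow>\<^sub>M count_space UNIV" if "j < n" for j
    using comp[OF that] by measurable
  have rank: "real (bid_rank n S j) = (\<Sum>l<n. if fst (S l) \<le> fst (S j) then 1 else 0)" for S j
    by (simp add: bid_rank_def sum.If_cases Int_def)
  have [measurable]: "(\<lambda>S. real (bid_rank n S j)) \<in> borel_measurable ?P" if "j < n" for j
    unfolding rank using that by (intro borel_measurable_sum) measurable
  have "(\<lambda>S. if snd (S j) = i \<and> x < fst (S j) then 1 - 1 / real (bid_rank n S j) else 1)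
      \<in> borel_measurable ?P" if "j < n" for j
    using that by measurable
  then show ?thesis
    unfolding kaplan_meier_eq_prod by (intro borel_measurable_prod) auto
qed

text \<open>Right-continuity makes the event of a uniformly small error measurable.\<close>

lemma kaplan_meier_close_iff_countable:
  assumes "continuous_on UNIV f" "p \<le> b"
  shows "(\<forall>x\<in>{p..b}. \<bar>kaplan_meier n S i x - f x\<bar> \<le> \<epsilon>) \<longleftrightarrow>
    (\<forall>x\<in>insert b ({p..b} \<inter> \<rat>). \<bar>kaplan_meier n S i x - f x\<bar> \<le> \<epsilon>)" (is "_ \<longleftrightarrow> ?R")
proof
  assume R: ?R
  show "\<forall>x\<in>{p..b}. \<bar>kaplan_meier n S i x - f x\<bar> \<le> \<epsilon>"
  proof (rule ballI, rule ccontr)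
    fix x assume x: "x \<in> {p..b}" and neg: "\<not> \<bar>kaplan_meier n S i x - f x\<bar> \<le> \<epsilon>"
    \<comment> \<open>\<open>b\<close> belongs to the countable set, so a violation occurs strictly
      below \<open>b\<close>, leaving room for a rational on its right.\<close>
    then have "x < b" using R by (cases "x = b") auto
    have "(f \<longlongrightarrow> f x) (at_right x)"
      using assms(1) by (meson UNIV_I continuous_on_def tendsto_within_subset subset_UNIV)
    then have "((\<lambda>y. \<bar>kaplan_meier n S i x - f y\<bar>) \<longlongrightarrow> \<bar>kaplan_meier n S i x - f x\<bar>) (at_right x)"
      by (intro tendsto_intros)
    then have "eventually (\<lambda>y. \<epsilon> < \<bar>kaplan_meier n S i x - f y\<bar>) (at_right x)"
      by (rule order_tendstoD) (use neg in simp)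
    with kaplan_meier_eventually_const[of n S i x]
    have "eventually (\<lambda>y. \<epsilon> < \<bar>kaplan_meier n S i y - f y\<bar>) (at_right x)"
      by eventually_elim simp
    then obtain c where c: "x < c" "\<And>y. x < y \<Longrightarrow> y < c \<Longrightarrow> \<epsilon> < \<bar>kaplan_meier n S i y - f y\<bar>"
      unfolding eventually_at_right_field by auto
    obtain q where q: "q \<in> \<rat>" "x < q" "q < min b c"
      using Rats_dense_in_real[of x "min b c"] \<open>x < b\<close> c(1) by auto
    then have "q \<in> insert b ({p..b} \<inter> \<rat>)" using x by auto
    with R have "\<bar>kaplan_meier n S i q - f q\<bar> \<le> \<epsilon>" by blast
    with c(2)[of q] q show False by simp
  qed
qed (use assms(2) in auto)

text \<open>In terms of \<open>L\<close> and \<open>r\<close> below,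
  \<open>f = L * r\<^sup>2\<close> and \<open>\<eta> = 1 / (24 * r)\<close>, so the exponent is of
  order \<open>L * ln f\<close>. The factor \<open>ln f\<close> absorbs the logarithm of the number
  of grid points, which is of order \<open>r\<close>.\<close>

lemma sample_size_bound:
  fixes k n :: nat and \<delta> \<gamma> \<epsilon> :: real
  assumes "2 \<le> k" "0 < \<delta>" "\<delta> < 1" "0 < \<gamma>" "\<gamma> \<le> 1" "0 < \<epsilon>" "\<epsilon> \<le> \<gamma> / 2"
    and f: "f = ln (real k / \<delta>) / (\<gamma> ^ 4 * \<epsilon>\<^sup>2)" "real n \<ge> 10000 * f * ln f powr 1"
    and \<eta>: "\<eta> = \<gamma>\<^sup>2 * \<epsilon> / 24"
  shows "0 < n" "4 * (real (nat \<lceil>1 / \<eta>\<rceil>) + 1) * exp (- 2 * real n * \<eta>\<^sup>2) \<le> \<delta>"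
proof -
  define L where "L = ln (real k / \<delta>)"
  define r where "r = 1 / (\<gamma>\<^sup>2 * \<epsilon>)"
  have r_pos: "0 < r" and "2 \<le> r"
  proof -
    have "\<gamma>\<^sup>2 * \<epsilon> \<le> 1 * (1 / 2)"
      using assms by (intro mult_mono) (auto simp: power_le_one)
    moreover have "0 < \<gamma>\<^sup>2 * \<epsilon>" using assms by simp
    ultimately show "2 \<le> r" "0 < r" by (auto simp: r_def field_simps)
  qed
  have "2 * 1 \<le> real k * (1 / \<delta>)"
    using assms by (intro mult_mono) auto
  then have kd: "2 \<le> real k / \<delta>" by simp
  then have "ln 2 \<le> L" unfolding L_def by (intro ln_mono) auto
  with ln2_ge_two_thirds have L: "2 / 3 \<le> L" by simp
  have fr: "f = L * r\<^sup>2"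
    unfolding f(1) L_def r_def by (simp add: power_divide power_mult_distrib flip: power_mult)
  have "2 / 3 * 2\<^sup>2 \<le> L * r\<^sup>2"
    using L \<open>2 \<le> r\<close> by (intro mult_mono power_mono) auto
  then have "2 \<le> f" by (simp add: fr)
  then have "ln 2 \<le> ln f" by (intro ln_mono) auto
  with ln2_ge_two_thirds have lnf: "2 / 3 \<le> ln f" by simp
  have n: "10000 * f * ln f \<le> real n"
    using f(2) lnf by simp
  show "0 < n"
    using n lnf \<open>2 \<le> f\<close> by (cases "n = 0") (auto simp: mult_le_0_iff)
  have \<eta>r: "\<eta> = 1 / (24 * r)" "0 < \<eta>" using assms by (simp_all add: \<eta> r_def)
  have "\<eta> \<le> 1" using \<eta>r \<open>2 \<le> r\<close> by simp
  \<comment> \<open>\<open>24 * r + 2 \<le> 48 * r\<close>, hence the constant 192 after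
    multiplication by 4.\<close>
  have "real (nat \<lceil>1 / \<eta>\<rceil>) + 1 \<le> 1 / \<eta> + 2"
    using \<eta>r(2) by (simp add: of_nat_ceiling) linarith
  also have "\<dots> \<le> 2 * (24 * r)"
    using \<open>2 \<le> r\<close> \<eta>r(1) by simp
  finally have N: "4 * (real (nat \<lceil>1 / \<eta>\<rceil>) + 1) \<le> 192 * r" by simp
  have "2 * real n * \<eta>\<^sup>2 \<ge> 2 * (10000 * f * ln f) * \<eta>\<^sup>2"
    using n by (intro mult_right_mono) auto
  also have "2 * (10000 * f * ln f) * \<eta>\<^sup>2 = 20000 / 576 * (L * ln f)"
    using r_pos by (simp add: fr \<eta>r(1) power_divide power_mult_distrib)
  finally have exponent: "30 * (L * ln f) \<le> 2 * real n * \<eta>\<^sup>2"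
  proof -
    assume *: "20000 / 576 * (L * ln f) \<le> 2 * real n * \<eta>\<^sup>2"
    have "30 * (L * ln f) \<le> 20000 / 576 * (L * ln f)"
      using L lnf by (intro mult_right_mono) auto
    with * show ?thesis by simp
  qed
  have "ln (192 * r / \<delta>) \<le> 30 * (L * ln f)"
  proof -
    have "(192 :: real) \<le> 2 ^ 8" by simp
    then have "ln 192 \<le> ln (2 ^ 8 :: real)" by (subst ln_le_cancel_iff) auto
    also have "\<dots> = 8 * ln 2" using ln_realpow[of "2 :: real" 8] by simp
    also have "\<dots> \<le> 8 * 1" using ln_2_less_1 by simp
    finally have 1: "ln 192 \<le> (8 :: real)" by simp
    have "r\<^sup>2 \<le> f * 2"
      using mult_right_mono[of "1 / 2" L "r\<^sup>2"] L by (simp add: fr)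
    then have "ln (r\<^sup>2) \<le> ln (f * 2)"
      using r_pos \<open>2 \<le> f\<close> by (subst ln_le_cancel_iff) auto
    then have 2: "2 * ln r \<le> ln f + 1"
      using r_pos \<open>2 \<le> f\<close> ln_2_less_1 by (simp add: ln_realpow ln_mult)
    have "1 / \<delta> \<le> real k / \<delta>" using assms by (intro divide_right_mono) auto
    then have 3: "ln (1 / \<delta>) \<le> L" unfolding L_def using assms by (intro ln_mono) auto
    have 4: "ln (192 * r / \<delta>) = ln 192 + ln r + ln (1 / \<delta>)"
      using r_pos \<open>0 < \<delta>\<close> by (simp add: ln_mult ln_div)
    \<comment> \<open>As \<open>L\<close> and \<open>ln f\<close> are at least \<open>2 / 3\<close>,
      each of them and every constant is at most a multiple of \<open>L * ln f\<close>; the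
      multiples add up to less than 30.\<close>
    have "2 / 3 * ln f \<le> L * ln f" "L * (2 / 3) \<le> L * ln f"
      using L lnf by (intro mult_right_mono mult_left_mono; simp)+
    then show ?thesis using 1 2 3 4 L lnf by linarith
  qed
  with exponent have "ln (192 * r / \<delta>) \<le> 2 * real n * \<eta>\<^sup>2" by linarith
  then have "exp (ln (192 * r / \<delta>)) \<le> exp (2 * real n * \<eta>\<^sup>2)" by simp
  then have "192 * r / \<delta> \<le> exp (2 * real n * \<eta>\<^sup>2)"
    using r_pos \<open>0 < \<delta>\<close> by simp
  then have "192 * r * exp (- 2 * real n * \<eta>\<^sup>2) \<le> \<delta>"
    using \<open>0 < \<delta>\<close> by (simp add: exp_minus field_simps)
  moreover have "4 * (real (nat \<lceil>1 / \<eta>\<rceil>) + 1) * exp (- 2 * real n * \<eta>\<^sup>2) \<le>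
      192 * r * exp (- 2 * real n * \<eta>\<^sup>2)"
    using N by (intro mult_right_mono) auto
  ultimately show "4 * (real (nat \<lceil>1 / \<eta>\<rceil>) + 1) * exp (- 2 * real n * \<eta>\<^sup>2) \<le> \<delta>" by linarith
qed

section \<open>From uniform deviations to the error of the estimator\<close>

locale continuous_auction = auction +
  assumes cont: "\<And>i. i \<in> {1..k} \<Longrightarrow> continuous_on UNIV (F i)"
    and support: "\<And>i. i \<in> {1..k} \<Longrightarrow> supported_01 (F i)"
begin

lemma continuous_on_G: "continuous_on A G"
  unfolding G_def[abs_def] using cont by (intro continuous_on_prod) (meson continuous_on_subset subset_UNIV)

lemma G_at_1: "G 1 = 1"
  using support by (simp add: G_def supported_01_def)

text \<open>Continuity excludes an atom at 0. So \<open>G\<close> rises from 0 to 1 on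
  \<open>{0..1}\<close>, and a quantile grid there has increments exactly
  \<open>1 / N\<close>.\<close>

lemma G_at_0: "G 0 = 0"
proof -
  have "F 1 0 = 0"
  proof (rule tendsto_unique)
    show "(F 1 \<longlongrightarrow> F 1 0) (at_left 0)"
      using cont[of 1] k_ge_2 by (simp add: continuous_on_def) (meson tendsto_within_subset subset_UNIV)
    have "eventually (\<lambda>x. F 1 x = 0) (at_left 0)"
      using support[of 1] k_ge_2 by (intro eventually_at_leftI[of "-1"]) (auto simp: supported_01_def)
    then show "(F 1 \<longlongrightarrow> 0) (at_left 0)" by (rule tendsto_eventually)
  qed simp
  then show ?thesis using k_ge_2 unfolding G_def by (intro prod_zero) auto
qed

lemma G_bounds: "0 \<le> G x" "G x \<le> 1"
  unfolding G_def using is_cdf_bounds[OF cdf] by (auto intro!: prod_nonneg prod_le_1)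

lemma H_bounds: "0 \<le> H i x" "H i x \<le> 1"
  using prob_space.prob_le_1[OF prob_space_law] by (auto simp: H_def)

lemma kaplan_meier_close:
  assumes i: "i \<in> {1..k}" and x: "p \<le> x" "x \<le> 1"
    and \<gamma>: "0 < \<gamma>" "\<gamma> \<le> 1" "\<gamma> \<le> G p" and \<eta>: "0 < \<eta>" "\<eta> \<le> \<gamma> / 2"
    and S: "\<And>j. j < n \<Longrightarrow> fst (S j) \<le> 1"
    and close: "\<And>y. y \<in> {p..1} \<Longrightarrow> \<bar>empirical n S (bids_upto y) - G y\<bar> \<le> \<eta>"
      "\<And>y. y \<in> {p..1} \<Longrightarrow> \<bar>empirical n S (wins_upto i y) - H i y\<bar> \<le> \<eta>"
  shows "\<bar>kaplan_meier n S i x - F i x\<bar> \<le> 12 * \<eta> / \<gamma>\<^sup>2"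
proof -
  let ?L = "\<lambda>y. - ln (F i y)" and ?L' = "\<lambda>y. - ln (kaplan_meier n S i y)"
  let ?G' = "\<lambda>y. empirical n S (bids_upto y)" and ?H' = "\<lambda>y. empirical n S (wins_upto i y)"
  have Gx: "\<gamma> \<le> G y" if "x \<le> y" for y
    using \<gamma>(3) monoD[OF mono_G, of p y] x that by simp
  have G'x: "0 < ?G' y" if "x \<le> y" "y \<le> 1" for y
    using close(1)[of y] Gx[of y] that \<gamma> \<eta> x by (auto simp: abs_le_iff)
  \<comment> \<open>Both hazards are anchored at 1: this product is empty, and
    \<open>F i 1 = 1\<close> by the support condition.\<close>
  have "kaplan_meier n S i 1 = 1"
  proof -
    have "{j. j < n \<and> snd (S j) = i \<and> 1 < fst (S j)} = {}"
      using S by force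
    then show ?thesis by (simp add: kaplan_meier_def del: Collect_empty_eq)
  qed
  then have "\<bar>?L' x - ?L x\<bar> \<le> 12 * \<eta> / \<gamma>\<^sup>2"
    using x \<gamma> \<eta> support[OF i] G_bounds[of x] G_bounds[of 1] H_bounds[of i x] H_bounds[of i 1]
      empirical_bounds[of n S "wins_upto i x"] empirical_bounds[of n S "wins_upto i 1"] Gx G'x i
    by (intro cumulative_hazard_close[where G=G and G'="?G'" and H="H i" and H'="?H'" and b=1
          and L="?L" and L'="?L'"])
      (auto intro!: mono_G mono_H continuous_on_G monoI empirical_mono close
        hazard_bounds_law kaplan_meier_hazard simp: supported_01_def less_le_trans[OF \<gamma>(1)])
  moreover have "\<bar>kaplan_meier n S i x - F i x\<bar> \<le> \<bar>ln (kaplan_meier n S i x) - ln (F i x)\<bar>"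
  proof (rule abs_diff_le_abs_ln_diff)
    show "kaplan_meier n S i x \<in> {0<..1}"
      using kaplan_meier_hazard(1)[of n S x 1 i] G'x[of x] kaplan_meier_bounds[of n S i x] x by auto
    show "F i x \<in> {0<..1}"
      using F_pos[OF i, of x] Gx[of x] \<gamma>(1) is_cdf_bounds[OF cdf[OF i]] by simp
  qed
  ultimately show ?thesis by linarith
qed

lemma prob_space_samples: "prob_space (auction_samples k F n)"
  unfolding auction_samples_def by (intro prob_space_PiM prob_space_law)

text \<open>The sample space contains bids above 1, where the anchoring at 1 fails; they form a null
  set because \<open>G 1 = 1\<close>.\<close>

lemma AE_samples_le_1: "AE S in auction_samples k F n. \<forall>j<n. fst (S j) \<le> 1"
proof -
  interpret law: prob_space law by (rule prob_space_law)
  have "measure law (bids_upto 1) = 1" by (simp add: measure_bids_upto G_at_1)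
  then have "AE yz in law. yz \<in> bids_upto 1"
    by (subst (asm) law.prob_eq_1) (auto intro: Times_in_sets_law)
  then have "AE yz in law. fst yz \<le> 1" by (auto simp: mem_Times_iff)
  then have "AE S in auction_samples k F n. fst (S j) \<le> 1" if "j < n" for j
    unfolding auction_samples_def using that prob_space_law
    by (intro AE_PiM_component[where P="\<lambda>yz. fst yz \<le> 1"]) auto
  then have "AE S in auction_samples k F n. \<forall>j\<in>{..<n}. fst (S j) \<le> 1"
    by (intro AE_finite_allI) auto
  then show ?thesis by (rule eventually_mono) auto
qed

lemma empirical_sets:
  assumes "E \<in> sets law"
  shows "{S \<in> space (auction_samples k F n). \<epsilon> \<le> \<bar>empirical n S E - c\<bar>} \<in> sets (auction_samples k F n)"
proof -
  let ?P = "auction_samples k F n"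
  have comp: "(\<lambda>S. S j) \<in> ?P \<rightarrow>\<^sub>M law" if "j < n" for j
    unfolding auction_samples_def using that by (intro measurable_component_singleton) auto
  have "(\<lambda>S. \<Sum>j<n. indicator E (S j) :: real) \<in> borel_measurable ?P"
    using assms comp by (intro borel_measurable_sum borel_measurable_indicator[THEN measurable_compose[rotated]]) auto
  moreover have "empirical n S E = (\<Sum>j<n. indicator E (S j)) / real n" for S
    by (simp add: empirical_def indicator_def sum.If_cases Int_def)
  ultimately show ?thesis by simp
qed

text \<open>A union bound over a grid of quantiles of the highest bid, with Hoeffding's inequality at
  each grid point, replaces the Dvoretzky--Kiefer--Wolfowitz inequality.\<close>

lemma prob_uniformly_close:
  assumes "0 < \<eta>" "0 < n"
  obtains B where "B \<in> sets (auction_samples k F n)"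
    "measure (auction_samples k F n) B \<le> 4 * (real (nat \<lceil>1 / \<eta>\<rceil>) + 1) * exp (- 2 * real n * \<eta>\<^sup>2)"
    "\<And>S y. S \<in> space (auction_samples k F n) - B \<Longrightarrow> y \<in> {0..1} \<Longrightarrow>
       \<bar>empirical n S (bids_upto y) - G y\<bar> \<le> 2 * \<eta> \<and>
       \<bar>empirical n S (wins_upto i y) - H i y\<bar> \<le> 2 * \<eta>"
proof -
  let ?P = "auction_samples k F n"
  interpret P: prob_space ?P by (rule prob_space_samples)
  define N where "N = nat \<lceil>1 / \<eta>\<rceil>"
  have N: "0 < N" "1 / real N \<le> \<eta>"
  proof -
    have "1 / \<eta> \<le> real N" "0 < 1 / \<eta>" using \<open>0 < \<eta>\<close> by (auto simp: N_def)
    then show "0 < N" by (cases N) auto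
    with \<open>1 / \<eta> \<le> real N\<close> show "1 / real N \<le> \<eta>" using \<open>0 < \<eta>\<close> by (simp add: field_simps)
  qed
  obtain t where t: "t 0 = 0" "t N = 1" "\<And>a. a < N \<Longrightarrow> t a \<le> t (Suc a)"
    "\<And>a. a < N \<Longrightarrow> G (t (Suc a)) - G (t a) = 1 / real N"
    using quantile_grid[of 0 1 G N] continuous_on_G mono_G N(1) by (auto simp: G_at_0 G_at_1)
  define dev where "dev E = {S \<in> space ?P. \<eta> \<le> \<bar>empirical n S E - measure law E\<bar>}" for E
  define B where "B = (\<Union>a\<in>{..N}. dev (bids_upto (t a)) \<union> dev (wins_upto i (t a)))"
  have dev: "dev E \<in> sets ?P" "measure ?P (dev E) \<le> 2 * exp (- 2 * real n * \<eta>\<^sup>2)"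
    if "E \<in> sets law" for E
    unfolding dev_def
     apply (rule empirical_sets[OF that])
    using empirical_deviation[OF prob_space_law that, of \<eta> n] assms by (simp add: auction_samples_def)
  have dev2: "dev (bids_upto y) \<in> sets ?P" "dev (wins_upto i y) \<in> sets ?P" for y
    by (auto intro!: dev Times_in_sets_law)
  show ?thesis
  proof
    show "B \<in> sets ?P" unfolding B_def using dev2 by blast
    have "measure ?P B \<le> (\<Sum>a\<in>{..N}. measure ?P (dev (bids_upto (t a)) \<union> dev (wins_upto i (t a))))"
      unfolding B_def using dev2 by (intro measure_UNION_le) auto
    \<comment> \<open>Two events at each of the \<open>N + 1\<close> grid points, each with the
      two-sided Hoeffding bound.\<close>
    also have "\<dots> \<le> (\<Sum>a\<in>{..N}. 4 * exp (- 2 * real n * \<eta>\<^sup>2))"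
    proof (rule sum_mono)
      fix a
      have "measure ?P (dev (bids_upto (t a)) \<union> dev (wins_upto i (t a))) \<le>
          measure ?P (dev (bids_upto (t a))) + measure ?P (dev (wins_upto i (t a)))"
        by (intro measure_Un_le dev2)
      also have "\<dots> \<le> 2 * exp (- 2 * real n * \<eta>\<^sup>2) + 2 * exp (- 2 * real n * \<eta>\<^sup>2)"
        by (intro add_mono dev Times_in_sets_law) auto
      finally show "measure ?P (dev (bids_upto (t a)) \<union> dev (wins_upto i (t a))) \<le> 4 * exp (- 2 * real n * \<eta>\<^sup>2)"
        by simp
    qed
    also have "\<dots> = 4 * (real N + 1) * exp (- 2 * real n * \<eta>\<^sup>2)" by (simp add: algebra_simps)
    finally show "measure ?P B \<le> 4 * (real (nat \<lceil>1 / \<eta>\<rceil>) + 1) * exp (- 2 * real n * \<eta>\<^sup>2)"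
      by (simp add: N_def)
  next
    fix S and y :: real assume S: "S \<in> space ?P - B" and y: "y \<in> {0..1}"
    have grid: "\<bar>empirical n S (bids_upto (t a)) - G (t a)\<bar> \<le> \<eta>"
      "\<bar>empirical n S (wins_upto i (t a)) - H i (t a)\<bar> \<le> \<eta>" if "a \<le> N" for a
      using S that by (auto simp: B_def dev_def measure_bids_upto H_def not_le less_imp_le)
    have fine: "G (t (Suc a)) - G (t a) \<le> \<eta>" "H i (t (Suc a)) - H i (t a) \<le> \<eta>" if "a < N" for a
      using t(4)[OF that] N(2) H_increment_le_G[OF t(3)[OF that], of i] by simp_all
    \<comment> \<open>One \<open>\<eta>\<close> is the sampling error at the grid points, the other
      the increment within a cell.\<close>
    have "\<bar>empirical n S (bids_upto y) - G y\<bar> \<le> \<eta> + \<eta>"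
      using y t N(1) grid fine
      by (intro uniform_close_from_grid[where t=t and M=N] mono_G monoI empirical_mono) auto
    moreover have "\<bar>empirical n S (wins_upto i y) - H i y\<bar> \<le> \<eta> + \<eta>"
      using y t N(1) grid fine
      by (intro uniform_close_from_grid[where t=t and M=N] mono_H monoI empirical_mono) auto
    ultimately show "\<bar>empirical n S (bids_upto y) - G y\<bar> \<le> 2 * \<eta> \<and>
       \<bar>empirical n S (wins_upto i y) - H i y\<bar> \<le> 2 * \<eta>"
      by simp
  qed
qed

theorem prob_estimate_close:
  assumes i: "i \<in> {1..k}" and \<delta>: "0 < \<delta>" "\<delta> < 1" and "0 \<le> p"
    and \<gamma>: "\<gamma> \<le> G p" and \<epsilon>: "0 < \<epsilon>" "\<epsilon> \<le> \<gamma> / 2"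
    and f: "f = ln (real k / \<delta>) / (\<gamma> ^ 4 * \<epsilon>\<^sup>2)" "real n \<ge> 10000 * f * ln f powr 1"
  shows "1 - \<delta> \<le> measure (auction_samples k F n) {S \<in> space (auction_samples k F n).
      \<forall>x\<in>{p..1}. \<bar>estimate km_prog k \<delta> n S i x - F i x\<bar> \<le> \<epsilon>}"
proof -
  let ?P = "auction_samples k F n"
  interpret P: prob_space ?P by (rule prob_space_samples)
  define T where "T = {S \<in> space ?P. \<forall>x\<in>{p..1}. \<bar>kaplan_meier n S i x - F i x\<bar> \<le> \<epsilon>}"
  have T_eq: "{S \<in> space ?P. \<forall>x\<in>{p..1}. \<bar>estimate km_prog k \<delta> n S i x - F i x\<bar> \<le> \<epsilon>} = T"
    unfolding T_def using \<open>0 \<le> p\<close> by (auto simp: estimate_km_prog(1))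
  have \<gamma>_pos: "0 < \<gamma>" "\<gamma> \<le> 1" using \<gamma> \<epsilon> G_bounds(2)[of p] by auto
  \<comment> \<open>Uniform closeness doubles the error to \<open>2 * \<eta>\<close>, and the hazard
    comparison then turns it into exactly \<open>\<epsilon>\<close>.\<close>
  define \<eta> where "\<eta> = \<gamma>\<^sup>2 * \<epsilon> / 24"
  have \<eta>: "0 < \<eta>" "2 * \<eta> \<le> \<gamma> / 2" "12 * (2 * \<eta>) / \<gamma>\<^sup>2 = \<epsilon>"
  proof -
    show "0 < \<eta>" "12 * (2 * \<eta>) / \<gamma>\<^sup>2 = \<epsilon>" using \<gamma>_pos \<epsilon> by (auto simp: \<eta>_def)
    have "\<gamma>\<^sup>2 * \<epsilon> \<le> 1 * (\<gamma> / 2)"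
      using \<gamma>_pos \<epsilon> by (intro mult_mono) (auto simp: power_le_one)
    then show "2 * \<eta> \<le> \<gamma> / 2" using \<gamma>_pos unfolding \<eta>_def by linarith
  qed
  note size = sample_size_bound[OF k_ge_2 \<delta> \<gamma>_pos \<epsilon> f \<eta>_def]
  obtain B where B: "B \<in> sets ?P"
    "measure ?P B \<le> 4 * (real (nat \<lceil>1 / \<eta>\<rceil>) + 1) * exp (- 2 * real n * \<eta>\<^sup>2)"
    "\<And>S y. S \<in> space ?P - B \<Longrightarrow> y \<in> {0..1} \<Longrightarrow>
       \<bar>empirical n S (bids_upto y) - G y\<bar> \<le> 2 * \<eta> \<and>
       \<bar>empirical n S (wins_upto i y) - H i y\<bar> \<le> 2 * \<eta>"
    using prob_uniformly_close[OF \<eta>(1) size(1), of i] by blast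
  \<comment> \<open>Measurability is what lets the probability of \<open>T\<close> be bounded below
    by that of a subset. For \<open>p > 1\<close> the interval is empty and \<open>T\<close> is the
    whole space.\<close>
  have T: "T \<in> sets ?P"
  proof (cases "p \<le> 1")
    case True
    have [measurable]: "(\<lambda>S. kaplan_meier n S i x) \<in> borel_measurable ?P" for x
      unfolding auction_samples_def by (rule kaplan_meier_measurable[OF sets_law])
    have "countable (insert 1 ({p..1} \<inter> \<rat>))"
      by (simp add: countable_Int2 countable_rat)
    then show ?thesis
      unfolding T_def kaplan_meier_close_iff_countable[OF cont[OF i] True]
      by (intro sets.sets_Collect_countable_All') measurable
  qed (simp add: T_def)
  have "1 - \<delta> \<le> 1 - measure ?P B" using B(2) size(2) by linarith
  also have "\<dots> = measure ?P (space ?P - B)" using B(1) by (rule P.prob_compl[symmetric])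
  \<comment> \<open>The inclusion holds up to the null set of samples with a bid above 1.\<close>
  also have "\<dots> \<le> measure ?P T"
  proof (rule P.finite_measure_mono_AE[OF _ T])
    show "AE S in ?P. S \<in> space ?P - B \<longrightarrow> S \<in> T"
      using AE_samples_le_1
    proof eventually_elim
      case (elim S)
      show ?case
      proof
        assume S: "S \<in> space ?P - B"
        have "\<bar>kaplan_meier n S i x - F i x\<bar> \<le> \<epsilon>" if "x \<in> {p..1}" for x
          unfolding \<eta>(3)[symmetric]
          by (rule kaplan_meier_close[OF i _ _ \<gamma>_pos \<gamma> _ \<eta>(2)])
            (use that elim B(3)[OF S] \<open>0 \<le> p\<close> \<eta>(1) in auto)
        then show "S \<in> T" using S by (auto simp: T_def)
      qed
    qed
  qed
  finally show ?thesis unfolding T_eq .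
qed

end

theorem theorem2p3:
  shows "\<exists>(alg :: com) (C :: real) (c :: real).
    C > 0 \<and> c \<ge> 1 \<and> polynomial_time alg \<and> outputs_cdfs alg \<and>
    (\<forall>(k :: nat) (F :: nat \<Rightarrow> real \<Rightarrow> real) (n :: nat) (\<delta> :: real) (p :: real) (\<gamma> :: real) (\<epsilon> :: real).
      k \<ge> 2 \<longrightarrow>
      (\<forall>i\<in>{1..k}. is_cdf (F i) \<and> continuous_on UNIV (F i) \<and> supported_01 (F i)) \<longrightarrow>
      0 < \<delta> \<longrightarrow> \<delta> < 1 \<longrightarrow>
      p \<ge> 0 \<longrightarrow> \<gamma> \<ge> 0 \<longrightarrow>
      measure (first_price_auction k F)
        {yz \<in> space (first_price_auction k F). fst yz \<le> p} \<ge> \<gamma> \<longrightarrow>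
      0 < \<epsilon> \<longrightarrow> \<epsilon> \<le> \<gamma> / 2 \<longrightarrow>
      (let f = ln (real k / \<delta>) / (\<gamma> ^ 4 * \<epsilon> ^ 2) in real n \<ge> C * f * (ln f) powr c) \<longrightarrow>
      (\<forall>i\<in>{1..k}.
        measure (auction_samples k F n)
          {S \<in> space (auction_samples k F n).
             \<forall>x\<in>{p..1}. \<bar>estimate alg k \<delta> n S i x - F i x\<bar> \<le> \<epsilon>} \<ge> 1 - \<delta>))"
\<comment> \<open>The constants are those of \<open>sample_size_bound\<close>. The program receives
  none of \<open>p\<close>, \<open>\<gamma>\<close> and \<open>\<epsilon>\<close>, so the same
  estimate serves all of them.\<close>
proof (rule exI[of _ km_prog], rule exI[of _ 10000], rule exI[of _ 1], intro conjI allI impI ballI)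
  fix k n i :: nat and F :: "nat \<Rightarrow> real \<Rightarrow> real" and \<delta> p \<gamma> \<epsilon> :: real
  assume *: "2 \<le> k" "\<forall>i\<in>{1..k}. is_cdf (F i) \<and> continuous_on UNIV (F i) \<and> supported_01 (F i)"
    "0 < \<delta>" "\<delta> < 1" "0 \<le> p" "0 < \<epsilon>" "\<epsilon> \<le> \<gamma> / 2" "i \<in> {1..k}"
    and \<gamma>: "\<gamma> \<le> measure (first_price_auction k F) {yz \<in> space (first_price_auction k F). fst yz \<le> p}"
    and n: "let f = ln (real k / \<delta>) / (\<gamma> ^ 4 * \<epsilon>\<^sup>2) in 10000 * f * ln f powr 1 \<le> real n"
  interpret continuous_auction k F by unfold_locales (use * in auto)
  have "{yz \<in> space law. fst yz \<le> p} = bids_upto p" by (auto simp: space_law)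
  with \<gamma> have "\<gamma> \<le> G p" by (simp add: measure_bids_upto)
  with * n show "1 - \<delta> \<le> measure (auction_samples k F n) {S \<in> space (auction_samples k F n).
      \<forall>x\<in>{p..1}. \<bar>estimate km_prog k \<delta> n S i x - F i x\<bar> \<le> \<epsilon>}"
    by (intro prob_estimate_close[OF _ _ _ _ _ _ _ refl]) (auto simp: Let_def)
qed (simp_all add: polynomial_time_km_prog outputs_cdfs_km_prog)

end
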